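(* Let $\varphi$ be the random homeomorphism of $[0,1]$ defined in the context. There exists a continuous function $f$ on the circle $\mathbb{T}$ satisfying $$|f(\delta)-f(0)| = O\left(\frac{1}{\log\log\log\frac{1}{|\delta|}}\right)\qquad\text{as } \delta\to 0$$ for which the Fourier expansion of $f\circ\varphi$ diverges at $0$ with probability $1$, i.e. almost surely the sequence $S_n(f\circ\varphi;0)$ does not converge as $n\to\infty$.
   Context: $\mathbb{T}$ is the circle group, identified with the interval $[0,1]$ with endpoints glued; functions on $\mathbb{T}$ are regarded as $1$-periodic functions on $\mathbb{R}$ (so $f(\delta)$ makes sense for negative $\delta$). Random homeomorphism: let $X_{n,k}$ ($n\ge 1$, $0<k<2^n$ odd) be independent random variables uniform on $[0,1]$. Set $\varphi(0)=0$, $\varphi(1)=1$ and, inductively in $n$, for odd $0<k<2^n$, $$\varphi(k2^{-n})=\varphi((k-1)2^{-n})+X_{n,k}\left(\varphi((k+1)2^{-n})-\varphi((k-1)2^{-n})\right).$$ This defines an increasing function on the dyadic rationals, which almost surely extends to a homeomorphism of $[0,1]$, again denoted $\varphi$. Since $\varphi(0)=0$ and $\varphi(1)=1$, $f\circ\varphi$ is again a continuous function on $\mathbb{T}$. Fourier partial sums: $S_n(g;x)=\int_0^1 D_n(x-t)g(t)\,dt$ with $D_n(x)=\frac{\sin((2n+1)\pi x)}{\sin(\pi x)}$. *)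

theory Defs
  imports "HOL-Probability.Probability"
begin

definition dyadic_index :: "(nat \<times> nat) set" where
  "dyadic_index = {(n, k). 1 \<le> n \<and> 0 < k \<and> k < 2 ^ n \<and> odd k}"

text \<open>\<open>dyadic_val x n k\<close> is the value of the function at the dyadic point \<open>k / 2 ^ n\<close>,
  for \<open>k \<le> 2 ^ n\<close>. An even \<open>k\<close> is reduced to the previous level; for odd \<open>k\<close> the two
  neighbours \<open>(k - 1) / 2 ^ n\<close> and \<open>(k + 1) / 2 ^ n\<close> are read off at the previous level.\<close>

fun dyadic_val :: "(nat \<Rightarrow> nat \<Rightarrow> real) \<Rightarrow> nat \<Rightarrow> nat \<Rightarrow> real" where
  "dyadic_val x 0 k = real k"
| "dyadic_val x (Suc n) k =
    (if even k then dyadic_val x n (k div 2)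
     else dyadic_val x n ((k - 1) div 2)
        + x (Suc n) k * (dyadic_val x n ((k + 1) div 2) - dyadic_val x n ((k - 1) div 2)))"

text \<open>The extension from the dyadic points to \<open>[0, 1]\<close>. It is total, and it coincides with the
  continuous extension whenever there is one: see \<open>dyadic_extension_unique\<close> below.
  Arguments outside \<open>[0, 1]\<close> are irrelevant.\<close>

definition dyadic_extension :: "(nat \<Rightarrow> nat \<Rightarrow> real) \<Rightarrow> real \<Rightarrow> real" where
  "dyadic_extension x t = Sup {dyadic_val x n k | n k. k \<le> 2 ^ n \<and> real k / 2 ^ n \<le> t}"

definition random_homeo :: "(nat \<Rightarrow> nat \<Rightarrow> 'w \<Rightarrow> real) \<Rightarrow> 'w \<Rightarrow> real \<Rightarrow> real" where
  "random_homeo X \<omega> = dyadic_extension (\<lambda>n k. X n k \<omega>)"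

text \<open>At integers the quotient is \<open>0\<close> rather than its limit \<open>2 n + 1\<close>;
  this is invisible to the integral below.\<close>

definition dirichlet_kernel :: "nat \<Rightarrow> real \<Rightarrow> real" where
  "dirichlet_kernel n x = sin ((2 * real n + 1) * pi * x) / sin (pi * x)"

definition fourier_partial_sum :: "nat \<Rightarrow> (real \<Rightarrow> real) \<Rightarrow> real \<Rightarrow> real" where
  "fourier_partial_sum n g x = (LBINT t:{0..1}. dirichlet_kernel n (x - t) * g t)"

lemma dyadic_val_level:
  "dyadic_val x (n + m) (k * 2 ^ m) = dyadic_val x n k"
  by (induction m) auto

lemma dyadic_val_recursion:
  assumes "odd k"
  shows "dyadic_val x (Suc n) k = dyadic_val x (Suc n) (k - 1)
    + x (Suc n) k * (dyadic_val x (Suc n) (k + 1) - dyadic_val x (Suc n) (k - 1))"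
  using assms by simp

lemma dyadic_val_step:
  assumes x: "\<And>n k. (n, k) \<in> dyadic_index \<Longrightarrow> x n k \<in> {0..1}"
    and "k < 2 ^ n"
  shows "dyadic_val x n k \<le> dyadic_val x n (Suc k)"
  using \<open>k < 2 ^ n\<close>
proof (induction n arbitrary: k)
  case 0
  then show ?case by simp
next
  case (Suc n)
  show ?case
  proof (cases "even k")
    case True
    then obtain j where k: "k = 2 * j" by blast
    have *: "dyadic_val x n j \<le> dyadic_val x n (Suc j)"
      using Suc k by simp
    have "x (Suc n) (Suc k) \<in> {0..1}"
      using Suc.prems True by (intro x) (auto simp: dyadic_index_def k)
    with * have "0 \<le> x (Suc n) (Suc k) * (dyadic_val x n (Suc j) - dyadic_val x n j)"
      by simp
    then show ?thesis by (simp add: k)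
  next
    case False
    then obtain j where k: "k = Suc (2 * j)" by (metis oddE Suc_eq_plus1)
    define a where "a = dyadic_val x n j"
    define b where "b = dyadic_val x n (Suc j)"
    define y where "y = x (Suc n) k"
    have *: "a \<le> b"
      unfolding a_def b_def using Suc k by simp
    have "y \<in> {0..1}"
      unfolding y_def using Suc.prems False by (intro x) (auto simp: dyadic_index_def k)
    then have "y * (b - a) \<le> 1 * (b - a)"
      using * by (intro mult_right_mono) auto
    then show ?thesis by (simp add: k a_def b_def y_def)
  qed
qed

lemma dyadic_val_mono:
  assumes x: "\<And>n k. (n, k) \<in> dyadic_index \<Longrightarrow> x n k \<in> {0..1}"
    and "j \<le> k" "k \<le> 2 ^ n"
  shows "dyadic_val x n j \<le> dyadic_val x n k"
  using \<open>j \<le> k\<close> \<open>k \<le> 2 ^ n\<close>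
proof (induction k rule: dec_induct)
  case (step i)
  then show ?case using dyadic_val_step[of x i n, OF x] by force
qed simp

lemma dyadic_extension_unique:
  assumes x: "\<And>n k. (n, k) \<in> dyadic_index \<Longrightarrow> x n k \<in> {0..1}"
    and g: "continuous_on {0..1} g"
    and eq: "\<And>n k. k \<le> 2 ^ n \<Longrightarrow> g (real k / 2 ^ n) = dyadic_val x n k"
    and t: "t \<in> {0..1}"
  shows "dyadic_extension x t = g t"
proof -
  define m where "m j = nat \<lfloor>t * 2 ^ j\<rfloor>" for j :: nat
  define d where "d j = real (m j) / 2 ^ j" for j :: nat
  have m_real: "real (m j) = of_int \<lfloor>t * 2 ^ j\<rfloor>" for j
    using t by (simp add: m_def)
  have d_le: "d j \<le> t" for j
    unfolding d_def m_real by (simp add: divide_le_eq)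
  have d_ge: "t - (1 / 2) ^ j \<le> d j" for j
  proof -
    have "t * 2 ^ j - 1 \<le> real (m j)" unfolding m_real by linarith
    then have "(t * 2 ^ j - 1) / 2 ^ j \<le> d j"
      unfolding d_def by (intro divide_right_mono) auto
    then show ?thesis by (simp add: diff_divide_distrib power_one_over)
  qed
  have m_le: "m j \<le> 2 ^ j" for j
  proof -
    have "real (m j) \<le> t * 2 ^ j" unfolding m_real by simp
    also have "\<dots> \<le> 1 * 2 ^ j" using t by (intro mult_right_mono) auto
    finally have "real (m j) \<le> real (2 ^ j)" by simp
    then show ?thesis by (simp only: of_nat_le_iff)
  qed
  have "(\<lambda>j. t - (1 / 2) ^ j) \<longlonglongrightarrow> t - 0"
    by (intro tendsto_intros LIMSEQ_power_zero) simp
  then have "d \<longlonglongrightarrow> t"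
    by (intro tendsto_sandwich[of "\<lambda>j. t - (1 / 2) ^ j" d sequentially "\<lambda>_. t"])
      (auto simp: d_le d_ge)
  moreover have "d j \<in> {0..1}" for j
    using t d_le[of j] by (simp add: d_def del: divide_le_eq_1_pos)
  ultimately have lim: "(\<lambda>j. g (d j)) \<longlonglongrightarrow> g t"
    using continuous_on_tendsto_compose[OF g, of d t sequentially] t by simp
  have gd: "g (d j) = dyadic_val x j (m j)" for j
    unfolding d_def using m_le by (rule eq)
  show ?thesis
    unfolding dyadic_extension_def
  proof (rule cSup_eq)
    fix y assume "y \<in> {dyadic_val x n k | n k. k \<le> 2 ^ n \<and> real k / 2 ^ n \<le> t}"
    then obtain n k where y: "y = dyadic_val x n k" "k \<le> 2 ^ n" "real k / 2 ^ n \<le> t"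
      by blast
    have "y \<le> g (d j)" if nj: "n \<le> j" for j
    proof -
      obtain i where j: "j = n + i" using le_Suc_ex[OF nj] by auto
      have "real k \<le> t * 2 ^ n" using y(3) by (simp add: divide_le_eq)
      then have "real k * 2 ^ i \<le> t * 2 ^ n * 2 ^ i" by (intro mult_right_mono) auto
      then have "real (k * 2 ^ i) \<le> t * 2 ^ j" by (simp add: j power_add mult.assoc)
      then have "k * 2 ^ i \<le> m j" unfolding m_def by (simp add: le_nat_floor)
      then have "dyadic_val x j (k * 2 ^ i) \<le> dyadic_val x j (m j)"
        using x m_le by (intro dyadic_val_mono) auto
      then show ?thesis by (simp add: gd y j dyadic_val_level)
    qed
    then show "y \<le> g t"
      by (intro LIMSEQ_le_const[OF lim]) auto
  next
    fix z assume z: "\<And>y. y \<in> {dyadic_val x n k | n k. k \<le> 2 ^ n \<and> real k / 2 ^ n \<le> t}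
      \<Longrightarrow> y \<le> z"
    have "g (d j) \<le> z" for j
      unfolding gd using m_le[of j] d_le[of j] by (intro z) (auto simp: d_def)
    then show "g t \<le> z"
      by (intro LIMSEQ_le_const2[OF lim]) auto
  qed
qed

end

theory Submission
  imports Defs
begin

text \<open>
  The function is \<open>f x = osc (frac x)\<close>, where \<open>osc x\<close> oscillates like \<open>1 / 2 + cos (ln x)\<close> (cut off
  to \<open>[0, 1]\<close>) with amplitude \<open>1 / ln (ln (ln (1 / x)))\<close>. The logarithm makes the picture near \<open>0\<close>
  invariant under dilation by \<open>exp (2 * pi)\<close>. With positive probability the homeomorphism restricted
  to \<open>[0, 2 powr - q]\<close> follows, at the dyadic points of the next \<open>m\<close> levels, a prescribed staircase
  up to a tiny error; on such a window \<open>f \<circ> \<phi>\<close> vanishes wherever \<open>sin (2 * n * pi * t)\<close> is negative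
  and is as large as its amplitude permits where the sine is large, for \<open>n = 2 ^ (q + m - 3)\<close>.

  Averages of \<open>J\<close> consecutive partial sums are integrals against \<open>average_kernel\<close>; with \<open>J = 2 ^ q\<close>
  the part outside \<open>[0, 1 / (2 * J)]\<close> is negligible, and a window contributes a harmonic sum of
  length \<open>2 ^ (m - 4)\<close> times the amplitude. A window of \<open>m\<close> levels has probability at least
  \<open>exp (- C * 8 ^ m)\<close>, so with high probability one occurs among the first \<open>exp (C' * 8 ^ m)\<close> levels,
  where the amplitude is still of order \<open>1 / m\<close>: the average is bounded away from \<open>0\<close>. Averages of
  \<open>S_J, \<dots>, S_{2 J - 1}\<close>, however, tend to \<open>0\<close> because \<open>f \<circ> \<phi>\<close> is continuous at \<open>0\<close>, so
  the partial sums cannot converge.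
\<close>

section \<open>Averages of Fourier partial sums\<close>

lemma abs_sin_nat_mult_le: "\<bar>sin (real n * x)\<bar> \<le> real n * \<bar>sin x\<bar>"
proof (induction n)
  case (Suc n)
  have "\<bar>sin (real (Suc n) * x)\<bar> \<le> \<bar>sin (real n * x)\<bar> * \<bar>cos x\<bar> + \<bar>cos (real n * x)\<bar> * \<bar>sin x\<bar>"
    by (simp add: algebra_simps sin_add abs_mult[symmetric])
  also have "\<dots> \<le> \<bar>sin (real n * x)\<bar> * 1 + 1 * \<bar>sin x\<bar>"
    by (intro add_mono mult_mono) (auto simp: abs_cos_le_one)
  finally show ?case using Suc.IH by (simp add: algebra_simps)
qed simp

text \<open>Jordan's inequality: the sine is concave on \<open>{0..pi}\<close> and so lies above its
  chord from \<open>0\<close> to \<open>pi / 2\<close>.\<close>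

lemma sin_pi_mult_ge:
  assumes "0 \<le> t" "t \<le> 1 / 2"
  shows "2 * t \<le> sin (pi * t)"
proof -
  have conc: "concave_on {0..pi} sin"
  proof (rule f''_le0_imp_concave)
    show "(sin has_real_derivative cos x) (at x)" for x :: real by (auto intro!: derivative_eq_intros)
    show "(cos has_real_derivative - sin x) (at x)" for x :: real by (auto intro!: derivative_eq_intros)
    show "- sin x \<le> 0" if "x \<in> {0..pi}" for x using that sin_ge_zero by auto
  qed auto
  have "(1 - 2*t) * sin 0 + (2*t) * sin (pi/2) \<le> sin ((1 - 2*t) *\<^sub>R 0 + (2*t) *\<^sub>R (pi/2))"
    using assms by (intro concave_onD[OF conc]) auto
  then show ?thesis by (simp add: mult.commute)
qed

text \<open>With \<open>a = 2 * N + J\<close> this is the mean of the Dirichlet kernels of orders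
  \<open>N, \<dots>, N + J - 1\<close>: see \<open>sum_dirichlet_kernel\<close>.\<close>

definition average_kernel :: "nat \<Rightarrow> nat \<Rightarrow> real \<Rightarrow> real" where
  "average_kernel a J t = sin (real a * (pi * t)) * sin (real J * (pi * t)) / (real J * (sin (pi * t))\<^sup>2)"

text \<open>Induction on \<open>J\<close>: one more kernel raises both sine arguments by
  \<open>\<theta>\<close>, and the product-to-sum formulas give the increment. At zeros of the sine
  both sides are \<open>0\<close> by the convention for division.\<close>

lemma sum_dirichlet_kernel:
  "(\<Sum>j<J. dirichlet_kernel (N + j) t) = real J * average_kernel (2 * N + J) J t"
proof (cases "sin (pi * t) = 0")
  case True
  then show ?thesis by (simp add: dirichlet_kernel_def average_kernel_def)
next
  case False
  define \<theta> where "\<theta> = pi * t"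
  have s: "sin \<theta> \<noteq> 0" using False by (simp add: \<theta>_def)
  have "(\<Sum>j<J. dirichlet_kernel (N + j) t) = sin (real (2 * N + J) * \<theta>) * sin (real J * \<theta>) / (sin \<theta>)\<^sup>2"
  proof (induction J)
    case (Suc J)
    define a where "a = real (2 * N + J) * \<theta>"
    define b where "b = real J * \<theta>"
    have 1: "real (2 * N + Suc J) * \<theta> = a + \<theta>" "real (Suc J) * \<theta> = b + \<theta>"
      "(2 * real (N + J) + 1) * \<theta> = a + b + \<theta>"
      by (simp_all add: a_def b_def algebra_simps)
    have "sin (a + \<theta>) * sin (b + \<theta>) = sin a * sin b + sin (a + b + \<theta>) * sin \<theta>"
    proof -
      have 2: "sin (a + \<theta>) * sin (b + \<theta>) = (cos (a - b) - cos (a + b + 2 * \<theta>)) / 2"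
        by (simp add: sin_times_sin algebra_simps)
      have 3: "sin a * sin b = (cos (a - b) - cos (a + b)) / 2"
        by (simp add: sin_times_sin)
      have 4: "sin (a + b + \<theta>) * sin \<theta> = (cos (a + b) - cos (a + b + 2 * \<theta>)) / 2"
        by (simp add: sin_times_sin add.assoc)
      show ?thesis unfolding 2 3 4 by (simp add: diff_divide_distrib)
    qed
    moreover have "dirichlet_kernel (N + J) t = sin (a + b + \<theta>) / sin \<theta>"
      unfolding dirichlet_kernel_def 1(3)[symmetric] by (simp add: \<theta>_def mult.assoc)
    ultimately show ?case
      using s Suc.IH unfolding 1 a_def[symmetric] b_def[symmetric]
      by (simp add: field_simps power2_eq_square)
  qed simp
  then show ?thesis
    by (simp add: average_kernel_def \<theta>_def)
qed

lemma abs_average_kernel_le: "\<bar>average_kernel a J t\<bar> \<le> real a"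
proof (cases "J = 0 \<or> sin (pi * t) = 0")
  case False
  have "\<bar>sin (real a * (pi * t))\<bar> * \<bar>sin (real J * (pi * t))\<bar>
      \<le> (real a * \<bar>sin (pi * t)\<bar>) * (real J * \<bar>sin (pi * t)\<bar>)"
    by (intro mult_mono abs_sin_nat_mult_le) auto
  moreover have "0 < real J * (sin (pi * t) * sin (pi * t))"
    using False by (auto simp: zero_less_mult_iff)
  ultimately show ?thesis
    by (simp add: average_kernel_def abs_mult divide_le_eq power2_eq_square mult_ac)
qed (auto simp: average_kernel_def)

text \<open>The gain from averaging: where the sine is bounded below the kernel is of order
  \<open>1 / J\<close>, uniformly in \<open>a\<close>, whereas single Dirichlet kernels do not decay
  there.\<close>

lemma abs_average_kernel_le_inverse:
  assumes "0 < c" "c \<le> \<bar>sin (pi * t)\<bar>"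
  shows "\<bar>average_kernel a J t\<bar> \<le> 1 / (real J * c\<^sup>2)"
proof (cases "J = 0")
  case False
  have "c\<^sup>2 \<le> (sin (pi * t))\<^sup>2"
    using assms by (metis abs_le_square_iff abs_of_pos)
  then have "real J * c\<^sup>2 \<le> real J * (sin (pi * t))\<^sup>2" by (intro mult_left_mono) auto
  moreover have "\<bar>sin (real a * (pi * t)) * sin (real J * (pi * t))\<bar> \<le> 1"
    by (simp add: abs_mult mult_le_one)
  ultimately show ?thesis
    using assms False by (auto simp: average_kernel_def abs_mult intro!: frac_le)
qed (auto simp: average_kernel_def)

lemma abs_dirichlet_kernel_le: "\<bar>dirichlet_kernel n t\<bar> \<le> 2 * real n + 1"
proof (cases "sin (pi * t) = 0")
  case False
  then show ?thesis
    using abs_sin_nat_mult_le[of "2 * n + 1" "pi * t"]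
    by (simp add: dirichlet_kernel_def field_simps)
qed (auto simp: dirichlet_kernel_def)

lemma average_kernel_measurable [measurable]: "average_kernel a J \<in> borel_measurable borel"
  unfolding average_kernel_def by measurable

lemma dirichlet_kernel_measurable [measurable]: "dirichlet_kernel n \<in> borel_measurable borel"
  unfolding dirichlet_kernel_def by measurable

lemma dirichlet_kernel_minus: "dirichlet_kernel n (- t) = dirichlet_kernel n t"
  by (simp add: dirichlet_kernel_def)

section \<open>Head and tail of the averaged integral\<close>

lemma bounded_set_integrable:
  fixes h :: "real \<Rightarrow> real"
  assumes "set_borel_measurable lborel S h" "S \<in> sets borel" "S \<subseteq> {0..1}" "\<And>t. t \<in> S \<Longrightarrow> \<bar>h t\<bar> \<le> C"
  shows "set_integrable lborel S h"
  unfolding set_integrable_def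
proof (rule Bochner_Integration.integrable_bound)
  show "integrable lborel (\<lambda>t::real. indicator {0..1} t *\<^sub>R \<bar>C\<bar>)"
    using integrable_real_indicator[of "{0..1::real}" lborel] by (simp add: mult.commute)
  show "(\<lambda>x. indicat_real S x *\<^sub>R h x) \<in> borel_measurable lborel"
    using assms(1) unfolding set_borel_measurable_def .
  show "AE t in lborel. norm (indicat_real S t *\<^sub>R h t) \<le> norm (indicat_real {0..1} t *\<^sub>R \<bar>C\<bar>)"
    using assms(3) order_trans[OF assms(4) abs_ge_self] by (intro AE_I2) (auto simp: indicator_def)
qed

text \<open>The abstract form of the composed function. Vanishing on \<open>{b..1}\<close> disposes
  of the singularity of the kernel at the other end \<open>1\<close>, so only the right limit at
  \<open>0\<close> has to be controlled.\<close>

locale bounded_at_circle =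
  fixes g :: "real \<Rightarrow> real" and b :: real
  assumes meas: "set_borel_measurable lborel {0..1} g"
    and bound: "\<And>t. t \<in> {0..1} \<Longrightarrow> \<bar>g t\<bar> \<le> 1"
    and b: "1 / 2 \<le> b" "b < 1"
    and zero: "\<And>t. t \<in> {b..1} \<Longrightarrow> g t = 0"
    and lim0: "(g \<longlongrightarrow> 0) (at_right 0)"
begin

lemma mult_measurable:
  assumes [measurable]: "h \<in> borel_measurable borel" "S \<in> sets borel" and "S \<subseteq> {0..1}"
  shows "set_borel_measurable lborel S (\<lambda>t. h t * g t)"
proof -
  have [measurable]: "(\<lambda>t. indicator {0..1} t *\<^sub>R g t) \<in> borel_measurable borel"
    using meas by (simp add: set_borel_measurable_def)
  have "(\<lambda>t. indicator S t *\<^sub>R (h t * (indicator {0..1} t *\<^sub>R g t))) \<in> borel_measurable borel"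
    by measurable
  moreover have "(\<lambda>t. indicator S t *\<^sub>R (h t * (indicator {0..1} t *\<^sub>R g t))) = (\<lambda>t. indicator S t *\<^sub>R (h t * g t))"
    using assms(3) by (auto simp: fun_eq_iff indicator_def)
  ultimately show ?thesis by (simp add: set_borel_measurable_def)
qed

lemma mult_integrable:
  assumes [measurable]: "h \<in> borel_measurable borel" "S \<in> sets borel" and S: "S \<subseteq> {0..1}"
    and C: "\<And>t. \<bar>h t\<bar> \<le> C"
  shows "set_integrable lborel S (\<lambda>t. h t * g t)"
proof (rule bounded_set_integrable[OF mult_measurable])
  fix t assume "t \<in> S"
  then have "\<bar>h t\<bar> * \<bar>g t\<bar> \<le> C * 1"
    using S bound C[of t] by (intro mult_mono order_trans[OF abs_ge_zero C]) auto
  then show "\<bar>h t * g t\<bar> \<le> C" by (simp add: abs_mult)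
qed (use S in auto)

lemma average_kernel_integrable:
  assumes "S \<in> sets borel" "S \<subseteq> {0..1}"
  shows "set_integrable lborel S (\<lambda>t. average_kernel a J t * g t)"
  by (rule mult_integrable[OF _ assms abs_average_kernel_le]) measurable

lemma average_fourier_partial_sum:
  assumes "J > 0"
  shows "(\<Sum>j<J. fourier_partial_sum (N + j) g 0) / real J
    = (LBINT t:{0..1}. average_kernel (2 * N + J) J t * g t)"
proof -
  have int: "set_integrable lborel {0..1} (\<lambda>t. dirichlet_kernel n t * g t)" for n
    by (rule mult_integrable[OF _ _ _ abs_dirichlet_kernel_le]) auto
  have "(\<Sum>j<J. fourier_partial_sum (N + j) g 0)
      = (\<Sum>j<J. LBINT t:{0..1}. dirichlet_kernel (N + j) t * g t)"
    by (simp add: fourier_partial_sum_def dirichlet_kernel_minus)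
  also have "\<dots> = (LBINT t:{0..1}. \<Sum>j<J. dirichlet_kernel (N + j) t * g t)"
    using int unfolding set_lebesgue_integral_def set_integrable_def scaleR_sum_right
    by (intro Bochner_Integration.integral_sum[symmetric]) auto
  also have "\<dots> = (LBINT t:{0..1}. real J * (average_kernel (2 * N + J) J t * g t))"
    by (simp add: sum_distrib_right[symmetric] sum_dirichlet_kernel mult.assoc)
  also have "\<dots> = real J * (LBINT t:{0..1}. average_kernel (2 * N + J) J t * g t)"
    by (rule set_integral_mult_right)
  finally show ?thesis using assms by simp
qed

lemma average_kernel_split:
  assumes "J > 0"
  shows "(LBINT t:{0..1}. average_kernel a J t * g t)
    = (LBINT t:{0..1 / (2 * real J)}. average_kernel a J t * g t)
      + (LBINT t:{1 / (2 * real J)<..1}. average_kernel a J t * g t)"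
proof -
  define r where "r = 1 / (2 * real J)"
  have "0 \<le> r" "r \<le> 1" using assms by (simp_all add: r_def)
  then have r: "{0..1} = {0..r} \<union> {r<..1}" "{0..r} \<subseteq> {0..1}" "{r<..1} \<subseteq> {0..1}"
    by auto
  show ?thesis
    unfolding r_def[symmetric]
    by (subst r(1)) (intro set_integral_Un average_kernel_integrable r(2,3); auto)
qed

lemma abs_set_integral_le:
  assumes "S \<in> sets borel" "S \<subseteq> {0..1}" "set_integrable lborel S h"
    and "\<And>t. t \<in> S \<Longrightarrow> \<bar>average_kernel a J t * g t\<bar> \<le> h t"
  shows "\<bar>LBINT t:S. average_kernel a J t * g t\<bar> \<le> (LBINT t:S. h t)"
proof -
  have "norm (LBINT t:S. average_kernel a J t * g t) \<le> (LBINT t:S. norm (average_kernel a J t * g t))"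
    using average_kernel_integrable[OF assms(1,2)] by (rule set_integral_norm_bound)
  also have "\<dots> \<le> (LBINT t:S. h t)"
    using assms by (intro set_integral_mono set_integrable_norm average_kernel_integrable) auto
  finally show ?thesis by simp
qed

text \<open>Uniformity in \<open>a\<close> matters because the frequency of a window is far larger
  than \<open>J\<close>. Near \<open>0\<close> the kernel is at most
  \<open>1 / (4 * J * t\<^sup>2)\<close> by Jordan's inequality, with integral at most
  \<open>1 / 2\<close> from \<open>1 / (2 * J)\<close> on, and \<open>g\<close> is small there. In
  the middle range the kernel is of order \<open>1 / J\<close>, and near \<open>1\<close> the
  function vanishes.\<close>

lemma tail_bound:
  assumes "\<epsilon> > 0"
  shows "\<forall>\<^sub>F J in sequentially. \<forall>a. \<bar>LBINT t:{1 / (2 * real J)<..1}. average_kernel a J t * g t\<bar> \<le> \<epsilon>"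
proof -
  have "\<forall>\<^sub>F t in at_right 0. \<bar>g t\<bar> < \<epsilon>"
    using lim0 assms by (auto simp: tendsto_iff dist_real_def)
  then obtain d where d: "d > 0" "\<And>t. 0 < t \<Longrightarrow> t < d \<Longrightarrow> \<bar>g t\<bar> < \<epsilon>"
    by (auto simp: eventually_at_right_field)
  \<comment> \<open>The cap \<open>1 / 2\<close> is the range of Jordan's inequality and keeps
    \<open>{\<delta>..b}\<close> nonempty.\<close>
  define \<delta> where "\<delta> = min d (1 / 2)"
  have \<delta>: "0 < \<delta>" "\<delta> \<le> 1 / 2" "\<And>t. 0 < t \<Longrightarrow> t < \<delta> \<Longrightarrow> \<bar>g t\<bar> < \<epsilon>"
    using d by (auto simp: \<delta>_def)
  have "\<exists>u\<in>{\<delta>..b}. \<forall>v\<in>{\<delta>..b}. sin (pi * u) \<le> sin (pi * v)"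
    using \<delta> b by (intro continuous_attains_inf continuous_intros) auto
  then obtain u where u: "u \<in> {\<delta>..b}" "\<And>v. v \<in> {\<delta>..b} \<Longrightarrow> sin (pi * u) \<le> sin (pi * v)"
    by blast
  define c where "c = sin (pi * u)"
  have c: "c > 0"
    unfolding c_def using u(1) \<delta>(1) b by (intro sin_gt_zero) auto
  have J: "\<bar>LBINT t:{1 / (2 * real J)<..1}. average_kernel a J t * g t\<bar> \<le> \<epsilon> / 2 + 1 / c\<^sup>2 * (1 / real J)"
    if "J > 0" for J a
  proof -
    define r where "r = 1 / (2 * real J)"
    note J0 = that
    have r: "0 < r" "r < 1" using that by (auto simp: r_def)
    define A where "A = \<epsilon> / (4 * real J)"
    define B where "B = 1 / (c\<^sup>2 * real J)"
    have AB: "0 \<le> A" "0 \<le> B" using assms by (auto simp: A_def B_def)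
    \<comment> \<open>\<open>h\<close> majorises the integrand on all three ranges at once: the
      first term serves small \<open>t\<close>, the constant serves the middle range.
      \<open>H\<close> is its antiderivative.\<close>
    define h where "h t = A * (1 / t\<^sup>2) + B" for t :: real
    define H where "H t = - A * (1 / t) + B * t" for t :: real
    have h_nonneg: "0 \<le> h t" for t using AB by (simp add: h_def)
    have int: "set_integrable lborel {r..1} h"
      unfolding h_def using r by (intro borel_integrable_atLeastAtMost' continuous_intros) auto
    have int': "set_integrable lborel {r<..1} h"
      by (rule set_integrable_subset[OF int]) auto
    have "(LBINT t:{r<..1}. h t) \<le> (LBINT t:{r..1}. h t)"
      unfolding set_lebesgue_integral_def
      using int int' h_nonneg
      by (intro integral_mono) (auto simp: set_integrable_def indicator_def)
    also have "\<dots> = H 1 - H r"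
      unfolding set_lebesgue_integral_def
    proof (rule integral_FTC_Icc)
      show "(H has_vector_derivative h t) (at t within {r..1})" if "r \<le> t" "t \<le> 1" for t
      proof -
        have "t \<noteq> 0" using that r by auto
        then have "(H has_real_derivative h t) (at t within {r..1})"
          unfolding H_def h_def by (auto intro!: derivative_eq_intros simp: power2_eq_square)
        then show ?thesis
          by (simp add: has_real_derivative_iff_has_vector_derivative)
      qed
      show "continuous_on {r..1} h"
        unfolding h_def using r by (intro continuous_intros) auto
    qed (use r in auto)
    also have "\<dots> \<le> \<epsilon> / 2 + 1 / c\<^sup>2 * (1 / real J)"
    proof -
      have "A * (1 / r) = \<epsilon> / 2" using that by (simp add: r_def A_def)
      moreover have "0 \<le> B * r" using r AB by simp
      moreover have "B = 1 / c\<^sup>2 * (1 / real J)" by (simp add: B_def)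
      ultimately show ?thesis using AB unfolding H_def by linarith
    qed
    finally have *: "(LBINT t:{r<..1}. h t) \<le> \<epsilon> / 2 + 1 / c\<^sup>2 * (1 / real J)" .
    have "\<bar>LBINT t:{r<..1}. average_kernel a J t * g t\<bar> \<le> (LBINT t:{r<..1}. h t)"
    proof (rule abs_set_integral_le)
      show "set_integrable lborel {r<..1} h"
        by (rule int')
      fix t assume t: "t \<in> {r<..1}"
      consider "t < \<delta>" | "t \<in> {\<delta>..b}" | "t > b" by fastforce
      then show "\<bar>average_kernel a J t * g t\<bar> \<le> h t"
      proof cases
        case 1
        have "2 * t \<le> sin (pi * t)" using 1 t r \<delta> by (intro sin_pi_mult_ge) auto
        then have "\<bar>average_kernel a J t\<bar> \<le> 1 / (real J * (2 * t)\<^sup>2)"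
          using t r by (intro abs_average_kernel_le_inverse) auto
        then have "\<bar>average_kernel a J t\<bar> * \<bar>g t\<bar> \<le> 1 / (real J * (2 * t)\<^sup>2) * \<epsilon>"
          using \<delta>(3)[of t] 1 t r by (intro mult_mono) auto
        also have "\<dots> = A * (1 / t\<^sup>2)"
          by (simp add: A_def power_mult_distrib)
        also have "\<dots> \<le> h t" using AB by (simp add: h_def)
        finally show ?thesis by (simp add: abs_mult)
      next
        case 2
        have "\<bar>average_kernel a J t\<bar> \<le> 1 / (real J * c\<^sup>2)"
          using u(2)[OF 2] c by (intro abs_average_kernel_le_inverse) (auto simp: c_def)
        then have "\<bar>average_kernel a J t\<bar> * \<bar>g t\<bar> \<le> 1 / (real J * c\<^sup>2) * 1"
          using bound[of t] t r by (intro mult_mono) auto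
        also have "\<dots> \<le> h t" using AB by (simp add: h_def B_def mult.commute)
        finally show ?thesis by (simp add: abs_mult)
      next
        case 3
        then show ?thesis using zero[of t] t h_nonneg by auto
      qed
    qed (use r in auto)
    then show ?thesis using * by (simp add: r_def)
  qed
  have "(\<lambda>J. 1 / c\<^sup>2 * (1 / real J)) \<longlonglongrightarrow> 1 / c\<^sup>2 * 0"
    by (intro tendsto_intros lim_1_over_n)
  then have "\<forall>\<^sub>F J in sequentially. 1 / c\<^sup>2 * (1 / real J) < \<epsilon> / 2"
    using assms by (intro order_tendstoD) auto
  then show ?thesis
    using eventually_gt_at_top[of 0]
  proof eventually_elim
    case (elim J)
    show ?case
    proof
      fix a
      show "\<bar>LBINT t:{1 / (2 * real J)<..1}. average_kernel a J t * g t\<bar> \<le> \<epsilon>"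
        using J[OF elim(2), of a] elim(1) by linarith
    qed
  qed
qed

text \<open>Here the frequency \<open>3 * J\<close> is comparable to \<open>J\<close>: the kernel is
  at most \<open>3 * J\<close> on an interval of length \<open>1 / (2 * J)\<close>, so the head is
  at most a constant times the size of \<open>g\<close> near \<open>0\<close>.\<close>

lemma head_zero:
  "(\<lambda>J. LBINT t:{0..1 / (2 * real J)}. average_kernel (3 * J) J t * g t) \<longlonglongrightarrow> 0"
proof (rule tendstoI)
  fix \<epsilon> :: real assume "\<epsilon> > 0"
  then have "\<forall>\<^sub>F t in at_right 0. \<bar>g t\<bar> < \<epsilon> / 3"
    using tendstoD[OF lim0, of "\<epsilon> / 3"] by (auto simp: dist_real_def)
  then obtain d where d: "d > 0" "\<And>t. 0 < t \<Longrightarrow> t < d \<Longrightarrow> \<bar>g t\<bar> < \<epsilon> / 3"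
    by (auto simp: eventually_at_right_field)
  have "(\<lambda>J. 1 / 2 * (1 / real J)) \<longlonglongrightarrow> 1 / 2 * 0"
    by (intro tendsto_intros lim_1_over_n)
  then have "\<forall>\<^sub>F J in sequentially. 1 / 2 * (1 / real J) < d"
    using d by (intro order_tendstoD) auto
  then show "\<forall>\<^sub>F J in sequentially. dist (LBINT t:{0..1 / (2 * real J)}. average_kernel (3 * J) J t * g t) 0 < \<epsilon>"
    using eventually_gt_at_top[of 0]
  proof eventually_elim
    case (elim J)
    have "\<bar>LBINT t:{0..1 / (2 * real J)}. average_kernel (3 * J) J t * g t\<bar>
      \<le> (LBINT t:{0..1 / (2 * real J)}. real J * \<epsilon>)"
    proof (rule abs_set_integral_le)
      show "set_integrable lborel {0..1 / (2 * real J)} (\<lambda>t. real J * \<epsilon>)"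
        by (simp add: set_integrable_def)
      fix t assume t: "t \<in> {0..1 / (2 * real J)}"
      show "\<bar>average_kernel (3 * J) J t * g t\<bar> \<le> real J * \<epsilon>"
      \<comment> \<open>\<open>lim0\<close> says nothing about the value \<open>g 0\<close>, but the
        kernel is \<open>0 / 0 = 0\<close> at this point.\<close>
      proof (cases "t = 0")
        case True
        then show ?thesis using \<open>\<epsilon> > 0\<close> by (simp add: average_kernel_def)
      next
        case False
        then have "\<bar>average_kernel (3 * J) J t\<bar> * \<bar>g t\<bar> \<le> real (3 * J) * (\<epsilon> / 3)"
          using t elim d(2)[of t] by (intro mult_mono abs_average_kernel_le) auto
        then show ?thesis by (simp add: abs_mult)
      qed
    qed (use elim in auto)
    also have "\<dots> = \<epsilon> / 2"
      using elim by (simp add: set_lebesgue_integral_def)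
    finally show ?case using \<open>\<epsilon> > 0\<close> by simp
  qed
qed

end

section \<open>Lower bounds for the head when the function oscillates in step with the
  kernel\<close>

lemma sin_ge_middle:
  assumes "pi / 4 \<le> x" "x \<le> 3 * pi / 4"
  shows "7 / 10 \<le> sin x"
proof -
  have "\<bar>x - pi / 2\<bar> \<le> pi / 4"
    unfolding abs_le_iff using assms by (intro conjI; linarith)
  then have "cos (pi / 4) \<le> cos \<bar>x - pi / 2\<bar>"
    by (intro cos_monotone_0_pi_le) auto
  also have "cos \<bar>x - pi / 2\<bar> = sin x"
    by (simp add: cos_diff)
  finally have "sqrt 2 / 2 \<le> sin x" by (simp add: cos_45)
  moreover have "7 / 5 \<le> sqrt 2"
    by (intro real_le_rsqrt) (simp add: power2_eq_square)
  ultimately show ?thesis by simp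
qed

text \<open>On the head the kernel is \<open>sin (2 * pi * n * t)\<close> times a weight of at least
  \<open>1 / (5 * t)\<close>, by Jordan's inequality in the numerator and
  \<open>pi\<^sup>2 \<le> 10\<close> in the denominator. The index \<open>i\<close> counts the
  periods of the sine, and \<open>14 / 100\<close> is \<open>7 / 10\<close> divided by
  \<open>5\<close>.\<close>

lemma average_kernel_window_ge:
  fixes n J i :: nat
  assumes "J > 0" "n > 0" and t: "0 < t" "t \<le> 1 / (2 * real J)"
    and i: "real i \<le> real n * t" "real n * t < real i + 1"
  shows "real n * t \<le> real i + 1 / 2 \<Longrightarrow> 0 \<le> average_kernel (2 * n) J t"
    and "real i + 1 / 8 \<le> real n * t \<Longrightarrow> real n * t \<le> real i + 3 / 8
      \<Longrightarrow> 14 / 100 * real n / (real i + 1) \<le> average_kernel (2 * n) J t"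
proof -
  define w where "w = sin (real J * (pi * t)) / (real J * (sin (pi * t))\<^sup>2)"
  define u where "u = real n * t - real i"
  have K: "average_kernel (2 * n) J t = sin (2 * pi * u) * w"
  proof -
    have "sin (real (2 * n) * (pi * t)) = sin (2 * pi * u + of_nat i * (2 * pi))"
      by (simp add: u_def algebra_simps)
    also have "\<dots> = sin (2 * pi * u)"
      using sin_2npi[of i] cos_2npi[of i] by (simp add: sin_add mult_ac)
    finally show ?thesis by (simp add: average_kernel_def w_def)
  qed
  have Jt: "real J * t \<le> 1 / 2" using t \<open>J > 0\<close> by (simp add: field_simps)
  have "1 / (2 * real J) \<le> 1 / 2" using \<open>J > 0\<close> by (simp add: field_simps)
  then have t1: "t \<le> 1 / 2" using t by linarith
  have s: "0 < sin (pi * t)"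
    using t1 t by (intro sin_gt_zero) auto
  have w: "1 / (5 * t) \<le> w"
  proof -
    have "2 * (real J * t) \<le> sin (pi * (real J * t))"
      using t Jt by (intro sin_pi_mult_ge) auto
    then have 1: "2 * (real J * t) \<le> sin (real J * (pi * t))" by (simp add: mult_ac)
    have "sin (pi * t) \<le> pi * t" using t by (intro sin_x_le_x) auto
    then have "(sin (pi * t))\<^sup>2 \<le> (pi * t)\<^sup>2" using s by (intro power_mono) auto
    also have "\<dots> \<le> 10 * t\<^sup>2"
    proof -
      have "pi \<le> 3.15" using pi_approx by simp
      then have "pi * pi \<le> 3.15 * 3.15" by (intro mult_mono) auto
      then have "pi\<^sup>2 \<le> 10" by (simp add: power2_eq_square)
      then show ?thesis by (simp add: power_mult_distrib mult_right_mono)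
    qed
    finally have 2: "real J * (sin (pi * t))\<^sup>2 \<le> real J * (10 * t\<^sup>2)"
      by (intro mult_left_mono) auto
    have "1 / (5 * t) = 2 * (real J * t) / (real J * (10 * t\<^sup>2))"
      using t \<open>J > 0\<close> by (simp add: field_simps power2_eq_square)
    also have "\<dots> \<le> w" unfolding w_def
      using 1 2 t s \<open>J > 0\<close> order_trans[OF _ 1, of 0] by (intro frac_le) auto
    finally show ?thesis .
  qed
  have "0 < 1 / (5 * t)" using t by simp
  then have w0: "0 < w" using w by linarith
  show "0 \<le> average_kernel (2 * n) J t" if "real n * t \<le> real i + 1 / 2"
  proof -
    have "0 \<le> sin (2 * pi * u)" using that i by (intro sin_ge_zero) (auto simp: u_def)
    then show ?thesis unfolding K using w0 by simp
  qed
  show "14 / 100 * real n / (real i + 1) \<le> average_kernel (2 * n) J t"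
    if "real i + 1 / 8 \<le> real n * t" "real n * t \<le> real i + 3 / 8"
  proof -
    have "1 / 8 \<le> u" "u \<le> 3 / 8" using that by (auto simp: u_def)
    then have "7 / 10 \<le> sin (2 * pi * u)"
      by (intro sin_ge_middle) (auto simp: field_simps)
    moreover have "real n / (5 * (real i + 1)) \<le> w"
    proof -
      have "t \<le> (real i + 1) / real n" using i \<open>n > 0\<close> by (simp add: field_simps)
      then have "5 * t \<le> 5 * ((real i + 1) / real n)" by (rule mult_left_mono) simp
      then have "1 / (5 * ((real i + 1) / real n)) \<le> 1 / (5 * t)"
        using t by (intro divide_left_mono mult_pos_pos) (auto simp: \<open>n > 0\<close>)
      then show ?thesis using w by simp
    qed
    ultimately have "7 / 10 * (real n / (5 * (real i + 1))) \<le> sin (2 * pi * u) * w"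
      by (intro mult_mono) auto
    then show ?thesis unfolding K by (simp add: field_simps)
  qed
qed

lemma averages_tendsto:
  fixes l :: real
  assumes "s \<longlonglongrightarrow> l" "\<epsilon> > 0"
  shows "\<forall>\<^sub>F N in sequentially. \<forall>N'\<ge>N. \<forall>J>0. \<bar>(\<Sum>j<J. s (N' + j)) / real J - l\<bar> \<le> \<epsilon>"
proof -
  obtain N0 where N0: "\<And>n. n \<ge> N0 \<Longrightarrow> \<bar>s n - l\<bar> < \<epsilon>"
    using assms by (auto simp: lim_sequentially dist_real_def)
  have "\<bar>(\<Sum>j<J. s (N + j)) / real J - l\<bar> \<le> \<epsilon>" if "N \<ge> N0" "J > 0" for N J
  proof -
    have "(\<Sum>j<J. s (N + j)) / real J - l = (\<Sum>j<J. s (N + j) - l) / real J"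
      using that by (simp add: sum_subtractf diff_divide_distrib)
    also have "\<bar>\<dots>\<bar> \<le> (\<Sum>j<J. \<epsilon>) / real J"
      using N0 that unfolding abs_divide
      by (intro divide_mono order_trans[OF sum_abs] sum_mono less_imp_le[OF N0]) auto
    finally show ?thesis using that by simp
  qed
  then show ?thesis by (auto simp: eventually_sequentially intro!: exI[of _ N0])
qed

context bounded_at_circle
begin

text \<open>The head consists of exactly \<open>P\<close> periods of length \<open>1 / n\<close>.
  The integrand is nonnegative on each, since \<open>g\<close> vanishes where the sine is negative.
  The piece \<open>I i\<close> around the crest has length \<open>1 / (4 * n)\<close> and
  contributes at least \<open>7 / 200 * A / (i + 1)\<close>.\<close>

lemma head_ge:
  fixes n J P :: nat
  assumes "J > 0" "n > 0" and P: "real P / real n = 1 / (2 * real J)" and "0 \<le> A"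
    and pos: "\<And>t. t \<in> {0..1} \<Longrightarrow> 0 \<le> g t"
    and small: "\<And>i t. i < P \<Longrightarrow> real i + 1 / 2 \<le> real n * t \<Longrightarrow> real n * t \<le> real i + 1 \<Longrightarrow> g t = 0"
    and big: "\<And>i t. i < P \<Longrightarrow> real i + 1 / 8 \<le> real n * t \<Longrightarrow> real n * t \<le> real i + 3 / 8 \<Longrightarrow> A \<le> g t"
  shows "7 / 200 * A * (\<Sum>i<P. 1 / (real i + 1))
    \<le> (LBINT t:{0..1 / (2 * real J)}. average_kernel (2 * n) J t * g t)"
proof -
  define I where "I i = {(real i + 1 / 8) / real n .. (real i + 3 / 8) / real n}" for i
  have mem_I: "t \<in> I i \<longleftrightarrow> real i + 1 / 8 \<le> real n * t \<and> real n * t \<le> real i + 3 / 8" for t i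
    using \<open>n > 0\<close> by (simp add: I_def field_simps)
  define low where "low t = (\<Sum>i<P. indicator (I i) t * (14 / 100 * real n / (real i + 1) * A))" for t
  have has: "has_bochner_integral lborel (\<lambda>t. indicator (I i) t * c) (1 / (4 * real n) * c)" for i c
  proof -
    have "has_bochner_integral lborel (indicator (I i)) (measure lborel (I i))"
      by (rule has_bochner_integral_real_indicator) (auto simp: I_def emeasure_lborel_Icc_eq)
    moreover have "measure lborel (I i) = 1 / (4 * real n)"
      using \<open>n > 0\<close> by (subst I_def) (simp add: divide_right_mono diff_divide_distrib[symmetric])
    ultimately show ?thesis by (intro has_bochner_integral_mult_left) auto
  qed
  have "has_bochner_integral lborel low (\<Sum>i<P. 1 / (4 * real n) * (14 / 100 * real n / (real i + 1) * A))"
    unfolding low_def by (intro has_bochner_integral_sum has)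
  moreover have "(\<Sum>i<P. 1 / (4 * real n) * (14 / 100 * real n / (real i + 1) * A))
    = 7 / 200 * A * (\<Sum>i<P. 1 / (real i + 1))"
    unfolding sum_distrib_left using \<open>n > 0\<close> by (intro sum.cong) (auto simp: field_simps)
  ultimately have low: "has_bochner_integral lborel low (7 / 200 * A * (\<Sum>i<P. 1 / (real i + 1)))"
    by (simp only:)
  have sub: "{0..1 / (2 * real J)} \<subseteq> {0..1}" using \<open>J > 0\<close> by (auto intro: order_trans)
  have pointwise: "low t \<le> indicator {0..1 / (2 * real J)} t * (average_kernel (2 * n) J t * g t)"
    (is "_ \<le> ?r") for t
  proof -
    have low0: "low t = 0" if "\<And>i. i < P \<Longrightarrow> t \<notin> I i"
      unfolding low_def using that by (intro sum.neutral) auto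
    show ?thesis
    proof (cases "0 < t \<and> t < real P / real n")
      case False
      have "t \<notin> I i" if "i < P" for i
      proof
        assume "t \<in> I i"
        then have *: "real i + 1 / 8 \<le> real n * t" "real n * t \<le> real i + 3 / 8" by (auto simp: mem_I)
        then have "0 < real n * t" by linarith
        then have "0 < t" by (simp add: zero_less_mult_iff)
        moreover have "real n * t < real P" using * that by linarith
        then have "t < real P / real n" using \<open>n > 0\<close> by (simp add: field_simps)
        ultimately show False using False by simp
      qed
      then have "low t = 0" by (rule low0)
      moreover have "?r = 0"
      proof (cases "t \<in> {0..1 / (2 * real J)}")
        case True
        \<comment> \<open>The two ends of the head are treated apart: at the right one
          \<open>n * t\<close> has integer part \<open>P\<close>, which indexes no period.\<close>
        then consider "t = 0" | "t = real P / real n" using False P by fastforce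
        then show ?thesis
        proof cases
          case 1
          then show ?thesis by (simp add: average_kernel_def)
        next
          case 2
          have "P > 0" using P \<open>J > 0\<close> by (intro gr0I) auto
          then have "g t = 0" using 2 \<open>n > 0\<close> by (intro small[of "P - 1"]) (auto simp: of_nat_diff)
          then show ?thesis by simp
        qed
      qed simp
      ultimately show ?thesis by (simp only: order_refl)
    next
      case True
      then have t: "0 < t" "t \<le> 1 / (2 * real J)" "t < real P / real n" using P by auto
      then have ind: "indicator {0..1 / (2 * real J)} t = (1::real)" by simp
      have g0: "0 \<le> g t" using pos t sub by auto
      define i where "i = nat \<lfloor>real n * t\<rfloor>"
      have nt: "0 \<le> real n * t" using t by simp
      have i: "real i \<le> real n * t" "real n * t < real i + 1"
        using nt by (auto simp: i_def)
      have "real n * t < real P" using t(3) \<open>n > 0\<close> by (simp add: field_simps)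
      then have iP: "i < P" using i by linarith
      have other: "t \<notin> I j" if "j \<noteq> i" for j
      proof
        assume "t \<in> I j"
        then have "real j < real i + 1" "real i < real j + 1" using i by (auto simp: mem_I)
        then show False using that by linarith
      qed
      have low_eq: "low t = indicator (I i) t * (14 / 100 * real n / (real i + 1) * A)"
        unfolding low_def using iP other by (subst sum.remove[of _ i]) (auto intro!: sum.neutral)
      note K = average_kernel_window_ge[OF \<open>J > 0\<close> \<open>n > 0\<close> t(1,2) i]
      show ?thesis
      proof (cases "t \<in> I i")
        case True
        then have "real i + 1 / 8 \<le> real n * t" "real n * t \<le> real i + 3 / 8" by (auto simp: mem_I)
        then have "14 / 100 * real n / (real i + 1) * A \<le> average_kernel (2 * n) J t * g t"
          using K big iP \<open>0 \<le> A\<close> by (intro mult_mono) auto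
        then show ?thesis using low_eq True ind by simp
      next
        case False
        then have "low t = 0" using low_eq by simp
        moreover have "0 \<le> average_kernel (2 * n) J t * g t"
        proof (cases "real n * t \<le> real i + 1 / 2")
          case True
          then show ?thesis using K(1) g0 by simp
        next
          case False
          then have "g t = 0" using i iP by (intro small[of i]) auto
          then show ?thesis by simp
        qed
        ultimately show ?thesis using ind by simp
      qed
    qed
  qed
  have "7 / 200 * A * (\<Sum>i<P. 1 / (real i + 1)) = (LBINT t. low t)"
    using low by (simp add: has_bochner_integral_integral_eq)
  also have "\<dots> \<le> (LBINT t. indicator {0..1 / (2 * real J)} t *\<^sub>R (average_kernel (2 * n) J t * g t))"
    using low average_kernel_integrable[OF _ sub, of "2 * n" J] pointwise
    by (intro integral_mono) (auto simp: set_integrable_def has_bochner_integral_iff)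
  finally show ?thesis by (simp add: set_lebesgue_integral_def)
qed

end

text \<open>Dyadic blocks of the harmonic sum: each block \<open>{2 ^ k..<2 ^ Suc k}\<close>
  contributes at least \<open>1 / 2\<close>.\<close>

lemma sum_inverse_power2_ge: "real k / 2 \<le> (\<Sum>i<2 ^ k. 1 / (real i + 1))"
proof (induction k)
  case (Suc k)
  have "1 / 2 = (\<Sum>i\<in>{2 ^ k..<2 ^ Suc k :: nat}. 1 / 2 ^ Suc k :: real)" by simp
  also have "\<dots> \<le> (\<Sum>i\<in>{2 ^ k..<2 ^ Suc k}. 1 / (real i + 1))"
  proof (intro sum_mono divide_left_mono)
    fix i :: nat assume "i \<in> {2 ^ k..<2 ^ Suc k}"
    then have "i + 1 \<le> 2 ^ Suc k" by simp
    then have "real (i + 1) \<le> real (2 ^ Suc k)" by (simp only: of_nat_le_iff)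
    then show "real i + 1 \<le> 2 ^ Suc k" by simp
  qed auto
  finally have "1 / 2 \<le> (\<Sum>i\<in>{2 ^ k..<2 ^ Suc k}. 1 / (real i + 1))" .
  moreover have "(\<Sum>i<2 ^ Suc k. 1 / (real i + 1)) = (\<Sum>i<2 ^ k. 1 / (real i + 1))
      + (\<Sum>i\<in>{2 ^ k..<2 ^ Suc k}. 1 / (real i + 1))"
    unfolding lessThan_atLeast0 by (rule sum.atLeastLessThan_concat[symmetric]) auto
  moreover have "real (Suc k) / 2 = real k / 2 + 1 / 2" by (simp add: add_divide_distrib)
  ultimately show ?case using Suc.IH by linarith
qed simp

section \<open>From windows to non-convergence of the partial sums\<close>

context bounded_at_circle
begin

text \<open>With \<open>N = J\<close> the frequency is \<open>3 * J\<close>, where head and tail are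
  both small. A nonzero limit would satisfy \<open>\<bar>l\<bar> \<le> 3 * \<epsilon>\<close>
  although \<open>\<epsilon> = \<bar>l\<bar> / 4\<close>.\<close>

lemma fourier_partial_sum_limit_0:
  assumes S: "(\<lambda>n. fourier_partial_sum n g 0) \<longlonglongrightarrow> l"
  shows "l = 0"
proof (rule ccontr)
  assume "l \<noteq> 0"
  define \<epsilon> where "\<epsilon> = \<bar>l\<bar> / 4"
  have \<epsilon>: "\<epsilon> > 0" using \<open>l \<noteq> 0\<close> by (simp add: \<epsilon>_def)
  have "\<forall>\<^sub>F J in sequentially. False"
    using averages_tendsto[OF S \<epsilon>] tail_bound[OF \<epsilon>] tendstoD[OF head_zero \<epsilon>] eventually_gt_at_top[of 0]
  proof eventually_elim
    case (elim J)
    have "\<bar>(\<Sum>j<J. fourier_partial_sum (J + j) g 0) / real J - l\<bar> \<le> \<epsilon>" using elim by blast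
    moreover have "2 * J + J = 3 * J" by simp
    then have "(\<Sum>j<J. fourier_partial_sum (J + j) g 0) / real J
       = (LBINT t:{0..1 / (2 * real J)}. average_kernel (3 * J) J t * g t)
        + (LBINT t:{1 / (2 * real J)<..1}. average_kernel (3 * J) J t * g t)"
      using average_fourier_partial_sum[OF elim(4), of J] average_kernel_split[OF elim(4)] by simp
    moreover have "\<bar>LBINT t:{0..1 / (2 * real J)}. average_kernel (3 * J) J t * g t\<bar> < \<epsilon>"
      using elim(3) by simp
    moreover have "\<bar>LBINT t:{1 / (2 * real J)<..1}. average_kernel (3 * J) J t * g t\<bar> \<le> \<epsilon>"
      using elim(2) by blast
    ultimately show False using \<epsilon> unfolding \<epsilon>_def by linarith
  qed
  then show False by simp
qed

text \<open>For \<open>J = 2 ^ q\<close> and \<open>n = 2 ^ (q + M - 3)\<close> the head consists of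
  exactly \<open>2 ^ (M - 4)\<close> periods. Their harmonic sum is of order \<open>M\<close> and
  cancels the amplitude \<open>1 / (6 * M)\<close>, so this average stays away from
  \<open>0\<close>, the only possible limit.\<close>

theorem not_convergent_fourier_partial_sum:
  assumes pos: "\<And>t. t \<in> {0..1} \<Longrightarrow> 0 \<le> g t"
    and windows: "\<And>m. \<exists>M q. m \<le> M \<and> M \<le> q \<and> (\<forall>i<2 ^ (M - 4). \<forall>t.
      (real i + 1 / 2 \<le> 2 ^ (q + M - 3) * t \<and> 2 ^ (q + M - 3) * t \<le> real i + 1 \<longrightarrow> g t = 0) \<and>
      (real i + 1 / 8 \<le> 2 ^ (q + M - 3) * t \<and> 2 ^ (q + M - 3) * t \<le> real i + 3 / 8 \<longrightarrow>
        1 / (6 * real M) \<le> g t))"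
  shows "\<not> convergent (\<lambda>n. fourier_partial_sum n g 0)"
proof
  assume "convergent (\<lambda>n. fourier_partial_sum n g 0)"
  then have S: "(\<lambda>n. fourier_partial_sum n g 0) \<longlonglongrightarrow> 0"
    using fourier_partial_sum_limit_0 by (auto simp: convergent_def)
  \<comment> \<open>Twice this value is below \<open>7 / 4800\<close>, the lower bound for the head
    obtained below; tail and average together cannot absorb it.\<close>
  define \<epsilon> :: real where "\<epsilon> = 1 / 2000"
  have \<epsilon>: "\<epsilon> > 0" by (simp add: \<epsilon>_def)
  obtain m1 where m1: "\<And>N J. N \<ge> m1 \<Longrightarrow> J > 0 \<Longrightarrow> \<bar>(\<Sum>j<J. fourier_partial_sum (N + j) g 0) / real J - 0\<bar> \<le> \<epsilon>"
    using averages_tendsto[OF S \<epsilon>] unfolding eventually_sequentially by blast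
  obtain m2 where m2: "\<And>J a. J \<ge> m2 \<Longrightarrow> \<bar>LBINT t:{1 / (2 * real J)<..1}. average_kernel a J t * g t\<bar> \<le> \<epsilon>"
    using tail_bound[OF \<epsilon>] unfolding eventually_sequentially by blast
  define m where "m = max m1 m2"
  obtain M q where Mq: "m + 8 \<le> M" "M \<le> q"
    and small: "\<And>i t. i < 2 ^ (M - 4) \<Longrightarrow> real i + 1 / 2 \<le> 2 ^ (q + M - 3) * t \<Longrightarrow> 2 ^ (q + M - 3) * t \<le> real i + 1 \<Longrightarrow> g t = 0"
    and big: "\<And>i t. i < 2 ^ (M - 4) \<Longrightarrow> real i + 1 / 8 \<le> 2 ^ (q + M - 3) * t \<Longrightarrow> 2 ^ (q + M - 3) * t \<le> real i + 3 / 8 \<Longrightarrow>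
        1 / (6 * real M) \<le> g t"
    using windows[of "m + 8"] by blast
  \<comment> \<open>Since \<open>M \<ge> 8\<close>, the exponent \<open>M - 4\<close> is at least
    \<open>M / 2\<close>, so the harmonic sum keeps a fixed proportion of \<open>M\<close>.\<close>
  define r where "r = M - 8"
  have M: "M = r + 8" and exps: "q + M - 3 = q + r + 5" "M - 4 = r + 4" using Mq by (auto simp: r_def)
  note small = small[unfolded exps] and big = big[unfolded exps]
  obtain q' where q: "q = Suc q'" using Mq by (cases q) auto
  define n where "n = (2::nat) ^ (q + r + 5)"
  define J where "J = (2::nat) ^ q"
  \<comment> \<open>\<open>2 ^ q'\<close> is \<open>J / 2\<close>; this choice makes the frequency
    \<open>2 * N + J\<close> equal to \<open>2 * n\<close>.\<close>
  define N where "N = n - 2 ^ q'"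
  have J0: "J > 0" and n0: "n > 0" by (auto simp: J_def n_def)
  have "(2::nat) ^ q' * 2 \<le> n" unfolding n_def q by (simp add: power_add)
  then have N: "2 * N + J = 2 * n" "2 ^ q' \<le> N" by (auto simp: N_def J_def q)
  have "m \<le> q'" using Mq q by simp
  also have "q' \<le> 2 ^ q'" using less_exp[of q'] by simp
  finally have mN: "m \<le> N" "m \<le> J" using N by (auto simp: J_def q)
  have "7 / 200 * (1 / (6 * real M)) * (\<Sum>i<2 ^ (r + 4). 1 / (real i + 1))
    \<le> (LBINT t:{0..1 / (2 * real J)}. average_kernel (2 * n) J t * g t)"
  proof (rule head_ge[OF J0 n0])
    show "real (2 ^ (r + 4)) / real n = 1 / (2 * real J)"
      by (simp add: n_def J_def field_simps power_add)
  qed (use pos small big in \<open>auto simp: n_def\<close>)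
  moreover have "7 / 4800 \<le> 7 / 200 * (1 / (6 * real M)) * (\<Sum>i<2 ^ (r + 4). 1 / (real i + 1))"
  proof -
    have "7 / 4800 \<le> 7 / 200 * (1 / (6 * real M)) * (real (r + 4) / 2)"
      unfolding M by (simp add: field_simps)
    also have "\<dots> \<le> 7 / 200 * (1 / (6 * real M)) * (\<Sum>i<2 ^ (r + 4). 1 / (real i + 1))"
      using sum_inverse_power2_ge[of "r + 4"] by (intro mult_left_mono) auto
    finally show ?thesis .
  qed
  moreover have "(\<Sum>j<J. fourier_partial_sum (N + j) g 0) / real J
       = (LBINT t:{0..1 / (2 * real J)}. average_kernel (2 * n) J t * g t)
        + (LBINT t:{1 / (2 * real J)<..1}. average_kernel (2 * n) J t * g t)"
    using average_fourier_partial_sum[OF J0, of N] average_kernel_split[OF J0] N(1) by simp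
  moreover have "\<bar>(\<Sum>j<J. fourier_partial_sum (N + j) g 0) / real J - 0\<bar> \<le> \<epsilon>"
    using mN(1) by (intro m1 J0) (simp add: m_def)
  moreover have "\<bar>LBINT t:{1 / (2 * real J)<..1}. average_kernel (2 * n) J t * g t\<bar> \<le> \<epsilon>"
    using mN(2) by (intro m2) (simp add: m_def)
  ultimately show False
    unfolding \<epsilon>_def by linarith
qed

end

section \<open>The oscillating function\<close>

definition hump :: "real \<Rightarrow> real" where
  "hump u = max 0 (min 1 (1 / 2 + cos u))"

text \<open>Two demands fix the exponent. It is an odd multiple of \<open>pi\<close>, so
  \<open>hump\<close> vanishes at \<open>ln osc_end\<close> and the cutoff is continuous. And
  \<open>9 * pi \<ge> 27 \<ge> exp (exp 1)\<close>, so the triple logarithm is at least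
  \<open>1\<close> up to this point.\<close>

definition osc_end :: real where
  "osc_end = exp (- (9 * pi))"

definition osc :: "real \<Rightarrow> real" where
  "osc x = (if 0 < x \<and> x < osc_end then hump (ln x) / ln (ln (ln (1 / x))) else 0)"

definition periodic_osc :: "real \<Rightarrow> real" where
  "periodic_osc x = osc (frac x)"

lemma hump_range: "0 \<le> hump u" "hump u \<le> 1"
  by (auto simp: hump_def)

lemma hump_eq_0: "cos u \<le> - (1 / 2) \<Longrightarrow> hump u = 0"
  by (auto simp: hump_def)

lemma hump_eq_1: "1 / 2 \<le> cos u \<Longrightarrow> hump u = 1"
  by (auto simp: hump_def)

lemma osc_end_bounds: "0 < osc_end" "osc_end < 1 / 2"
proof -
  show "0 < osc_end" by (simp add: osc_end_def)
  have "1 + 1 < exp (9 * pi)"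
    using exp_ge_add_one_self[of "9 * pi"] pi_gt3 by linarith
  then show "osc_end < 1 / 2" by (simp add: osc_end_def exp_minus field_simps)
qed

lemma hump_osc_end: "hump (ln osc_end) = 0"
proof -
  have "cos (real 9 * pi) = (- 1) ^ 9" by (rule cos_npi)
  then show ?thesis by (intro hump_eq_0) (simp add: osc_end_def)
qed

lemma ln_ln_ln_ge_1:
  assumes "0 < x" "x \<le> osc_end"
  shows "1 \<le> ln (ln (ln (1 / x)))" "27 \<le> ln (1 / x)"
proof -
  have "ln x \<le> ln osc_end" using assms by simp
  also have "\<dots> = - (9 * pi)" by (simp add: osc_end_def)
  finally have "9 * pi \<le> ln (1 / x)" using assms by (simp add: ln_div)
  then show 1: "27 \<le> ln (1 / x)" using pi_gt3 by linarith
  have "exp (exp 1) \<le> exp (3::real)" using exp_le by simp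
  also have "\<dots> = exp 1 ^ 3" by (simp add: exp_of_nat_mult[symmetric])
  also have "\<dots> \<le> 3 ^ 3" using exp_le by (intro power_mono) auto
  also have "\<dots> = (27::real)" by simp
  also note 1
  finally have "exp 1 \<le> ln (ln (1 / x))" using 1 by (subst ln_ge_iff) auto
  then show "1 \<le> ln (ln (ln (1 / x)))"
    by (subst ln_ge_iff) (auto intro: less_le_trans[OF exp_gt_zero])
qed

lemma osc_range: "0 \<le> osc x" "osc x \<le> 1"
proof -
  have "0 \<le> osc x \<and> osc x \<le> 1"
  proof (cases "0 < x \<and> x < osc_end")
    case True
    then have "1 \<le> ln (ln (ln (1 / x)))" by (intro ln_ln_ln_ge_1) auto
    then show ?thesis using True hump_range[of "ln x"] by (auto simp: osc_def divide_le_eq)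
  qed (auto simp: osc_def)
  then show "0 \<le> osc x" "osc x \<le> 1" by auto
qed

lemma osc_le:
  assumes "0 < x" "x \<le> osc_end"
  shows "osc x \<le> 1 / ln (ln (ln (1 / x)))"
proof -
  have "1 \<le> ln (ln (ln (1 / x)))" using assms by (rule ln_ln_ln_ge_1)
  then have "hump (ln x) / ln (ln (ln (1 / x))) \<le> 1 / ln (ln (ln (1 / x)))"
    and "0 \<le> 1 / ln (ln (ln (1 / x)))"
    using hump_range[of "ln x"] by (auto intro: divide_right_mono)
  then show ?thesis unfolding osc_def by (simp split: if_split)
qed

text \<open>As \<open>hump\<close> vanishes at \<open>ln osc_end\<close>, clamping the argument
  reproduces the cutoff, and this form is visibly continuous on the positive axis.\<close>

lemma osc_eq_min:
  assumes "0 < x"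
  shows "osc x = hump (ln (min x osc_end)) / ln (ln (ln (1 / min x osc_end)))"
  using assms hump_osc_end by (cases "x < osc_end") (auto simp: osc_def min_def)

lemma continuous_osc: "continuous_on UNIV osc"
proof (intro continuous_at_imp_continuous_on ballI)
  fix x :: real
  consider "x < 0" | "x > 0" | "x = 0" by linarith
  then show "isCont osc x"
  proof cases
    case 1
    then have "\<forall>\<^sub>F y in nhds x. osc y = 0"
      by (intro eventually_mono[OF eventually_nhds_in_open[of "{..<0}" x]]) (auto simp: osc_def)
    then show ?thesis by (subst isCont_cong[where g = "\<lambda>_. 0"]) auto
  next
    case 2
    let ?h = "\<lambda>x. hump (ln (min x osc_end)) / ln (ln (ln (1 / min x osc_end)))"
    have "\<forall>\<^sub>F y in nhds x. osc y = ?h y"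
      using 2 osc_eq_min by (intro eventually_mono[OF eventually_nhds_in_open[of "{0<..}" x]]) auto
    moreover have "isCont ?h x"
    proof -
      define m where "m = min x osc_end"
      have m: "0 < m" "m \<le> osc_end" using 2 osc_end_bounds by (auto simp: m_def)
      have "exp 1 \<le> ln (ln (1 / m))"
      proof -
        have "27 \<le> ln (1 / m)" "1 \<le> ln (ln (ln (1 / m)))" using ln_ln_ln_ge_1[OF m] by auto
        moreover have "0 < ln (ln (1 / m))" using \<open>27 \<le> ln (1 / m)\<close> by (intro ln_gt_zero) auto
        ultimately show ?thesis by (simp add: ln_ge_iff)
      qed
      then have "0 < ln (ln (1 / m))" by (rule less_le_trans[OF exp_gt_zero])
      then show ?thesis
        using ln_ln_ln_ge_1[OF m] m unfolding hump_def
        by (intro continuous_intros) (auto simp: m_def[symmetric])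
    qed
    ultimately show ?thesis by (subst isCont_cong) auto
  next
    case 3
    have "((\<lambda>x. 1 / ln (ln (ln (1 / x)))) \<longlongrightarrow> 0) (at_right (0::real))"
      using filterlim_compose[OF ln_at_top filterlim_compose[OF ln_at_top
          filterlim_compose[OF ln_at_top filterlim_inverse_at_top_right]]]
      unfolding inverse_eq_divide[symmetric] by (rule tendsto_inverse_0_at_top)
    moreover have "\<forall>\<^sub>F x in at_right 0. osc x \<le> 1 / ln (ln (ln (1 / x)))"
      using eventually_at_right_real[OF osc_end_bounds(1)]
      by eventually_elim (auto intro!: osc_le)
    ultimately have "(osc \<longlongrightarrow> 0) (at_right 0)"
      using osc_range by (intro tendsto_sandwich[of "\<lambda>_. 0" osc]) auto
    moreover have "(osc \<longlongrightarrow> 0) (at_left 0)"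
      using eventually_at_left_real[of "-1" 0]
      by (intro tendsto_eventually) (auto simp: osc_def elim!: eventually_mono)
    moreover have "osc 0 = 0" by (simp add: osc_def)
    ultimately show ?thesis unfolding 3 isCont_def
      by (simp add: filterlim_split_at)
  qed
qed

lemma osc_outside: "x \<le> 0 \<or> osc_end \<le> x \<Longrightarrow> osc x = 0"
  by (auto simp: osc_def)

text \<open>Near every point, integers included, the function is a single translate of
  \<open>osc\<close>, because \<open>osc\<close> vanishes left of \<open>0\<close> and from
  \<open>osc_end < 1 / 2\<close> on.\<close>

lemma continuous_periodic_osc: "continuous_on UNIV periodic_osc"
proof (intro continuous_at_imp_continuous_on ballI)
  fix a :: real
  define m where "m = real_of_int \<lfloor>a\<rfloor>"
  have "periodic_osc x = osc (x - m)" if x: "x \<in> {m - 1 / 2<..<m + 1}" for x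
  proof (cases "m \<le> x")
    case True
    then have "frac x = x - m" using x by (subst frac_unique_iff) (auto simp: m_def)
    then show ?thesis by (simp add: periodic_osc_def)
  next
    case False
    then have "frac x = x - m + 1" using x by (subst frac_unique_iff) (auto simp: m_def)
    then have "osc (frac x) = 0" using x osc_end_bounds by (intro osc_outside) auto
    moreover have "osc (x - m) = 0" using False by (intro osc_outside) auto
    ultimately show ?thesis by (simp add: periodic_osc_def)
  qed
  moreover have "a \<in> {m - 1 / 2<..<m + 1}"
    unfolding m_def greaterThanLessThan_iff by linarith
  ultimately have "\<forall>\<^sub>F x in nhds a. periodic_osc x = osc (x - m)"
    by (intro eventually_mono[OF eventually_nhds_in_open[of "{m - 1 / 2<..<m + 1}" a]]) auto
  moreover have "isCont osc (a - m)"
    using continuous_osc by (rule continuous_on_interior) simp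
  then have "isCont (\<lambda>x. osc (x - m)) a"
    by (rule isCont_o2[rotated]) simp
  ultimately show "isCont periodic_osc a"
    using isCont_cong[of periodic_osc "\<lambda>x. osc (x - m)" a] by blast
qed

lemma periodic_osc_periodic: "periodic_osc (x + 1) = periodic_osc x"
  by (simp add: periodic_osc_def frac_1_eq)

lemma periodic_osc_eq_osc: "0 \<le> x \<Longrightarrow> x < 1 \<Longrightarrow> periodic_osc x = osc x"
  by (simp add: periodic_osc_def frac_eq[THEN iffD2])

lemma periodic_osc_range: "0 \<le> periodic_osc x" "periodic_osc x \<le> 1"
  by (simp_all add: periodic_osc_def osc_range)

lemma periodic_osc_eq_0:
  assumes "1 / 2 \<le> x" "x \<le> 1"
  shows "periodic_osc x = 0"
proof (cases "x = 1")
  case True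
  then show ?thesis by (simp add: periodic_osc_def osc_def)
next
  case False
  then show ?thesis using assms osc_end_bounds by (subst periodic_osc_eq_osc) (auto intro!: osc_outside)
qed

lemma periodic_osc_bigo:
  "(\<lambda>\<delta>. periodic_osc \<delta> - periodic_osc 0) \<in> O[at 0](\<lambda>\<delta>. 1 / ln (ln (ln (1 / \<bar>\<delta>\<bar>))))"
proof (rule landau_o.big_mono)
  have "\<forall>\<^sub>F \<delta> in at 0. \<delta> \<noteq> 0 \<and> dist \<delta> 0 < osc_end"
    using osc_end_bounds by (auto simp: eventually_at intro!: exI[of _ osc_end])
  then show "\<forall>\<^sub>F \<delta> in at 0. norm (periodic_osc \<delta> - periodic_osc 0)
      \<le> norm (1 / ln (ln (ln (1 / \<bar>\<delta>\<bar>))))"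
  proof eventually_elim
    case (elim \<delta>)
    have 0: "periodic_osc 0 = 0" by (simp add: periodic_osc_def osc_def)
    show ?case
    proof (cases "\<delta> > 0")
      case True
      then have "periodic_osc \<delta> = osc \<delta>" using elim osc_end_bounds by (intro periodic_osc_eq_osc) auto
      moreover have "osc \<delta> \<le> 1 / ln (ln (ln (1 / \<delta>)))" using True elim by (intro osc_le) auto
      ultimately show ?thesis using 0 True elim ln_ln_ln_ge_1(1)[of \<delta>] by (simp add: osc_range)
    next
      case False
      have "periodic_osc \<delta> = periodic_osc (\<delta> + 1)" by (simp add: periodic_osc_periodic)
      also have "\<dots> = 0" using False elim osc_end_bounds by (intro periodic_osc_eq_0) auto
      finally show ?thesis using 0 by simp
    qed
  qed
qed

section \<open>Homeomorphisms given by splitting ratios\<close>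

lemma dyadic_val_0: "dyadic_val x n 0 = 0"
  by (induction n) auto

lemma dyadic_val_top: "dyadic_val x n (2 ^ n) = 1"
  by (induction n) auto

lemma dyadic_val_Suc_1: "dyadic_val x (Suc n) 1 = x (Suc n) 1 * dyadic_val x n 1"
  by (simp add: dyadic_val_0)

lemma dyadic_val_1: "dyadic_val x n 1 = (\<Prod>i=1..n. x i 1)"
  by (induction n) (simp_all add: dyadic_val_Suc_1 mult.commute del: dyadic_val.simps(2) One_nat_def)

text \<open>Self-similarity: in the leftmost cell of level \<open>q\<close> the construction starts
  afresh with the ratios of the deeper levels, scaled by the value at the right end of that
  cell.\<close>

lemma dyadic_val_subtree:
  assumes "j \<le> 2 ^ s"
  shows "dyadic_val x (q + s) j = dyadic_val x q 1 * dyadic_val (\<lambda>s j. x (q + s) j) s j"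
  using assms
proof (induction s arbitrary: j)
  case 0
  then have "j = 0 \<or> j = 1" by auto
  then show ?case by (auto simp: dyadic_val_0)
next
  case (Suc s)
  show ?case
  proof (cases "even j")
    case True
    then show ?thesis using Suc by auto
  next
    case False
    then obtain i where j: "j = 2 * i + 1" by (blast elim: oddE)
    have "2 * i + 1 \<le> 2 * 2 ^ s" using Suc.prems j by simp
    then have "i + 1 \<le> 2 ^ s" by linarith
    then have "dyadic_val x (q + s) (i + 1) = dyadic_val x q 1 * dyadic_val (\<lambda>s j. x (q + s) j) s (i + 1)"
      "dyadic_val x (q + s) i = dyadic_val x q 1 * dyadic_val (\<lambda>s j. x (q + s) j) s i"
      using Suc.IH by auto
    then show ?thesis by (simp add: j algebra_simps)
  qed
qed

locale splitting_ratios =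
  fixes x :: "nat \<Rightarrow> nat \<Rightarrow> real"
  assumes ratio: "(n, k) \<in> dyadic_index \<Longrightarrow> x n k \<in> {0..1}"
begin

lemma dyadic_val_range:
  assumes "k \<le> 2 ^ n"
  shows "dyadic_val x n k \<in> {0..1}"
  using dyadic_val_mono[of x 0 k n] dyadic_val_mono[of x k "2 ^ n" n] assms ratio
  by (auto simp: dyadic_val_0 dyadic_val_top)

lemma extension_set:
  assumes "0 \<le> t"
  defines "A \<equiv> {dyadic_val x n k | n k. k \<le> 2 ^ n \<and> real k / 2 ^ n \<le> t}"
  shows "A \<noteq> {}" "A \<subseteq> {0..1}" "bdd_above A"
proof -
  have "dyadic_val x 0 0 \<in> A" using assms(1) unfolding A_def
    by (intro CollectI exI[of _ 0]) auto
  then show "A \<noteq> {}" by blast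
  show "A \<subseteq> {0..1}" using dyadic_val_range unfolding A_def by blast
  then show "bdd_above A" by (meson bdd_above_Icc bdd_above_mono)
qed

lemma dyadic_extension_range:
  assumes "0 \<le> t"
  shows "dyadic_extension x t \<in> {0..1}"
proof -
  note A = extension_set[OF assms]
  obtain a where "a \<in> {dyadic_val x n k | n k. k \<le> 2 ^ n \<and> real k / 2 ^ n \<le> t}" using A(1) by blast
  then have "0 \<le> Sup {dyadic_val x n k | n k. k \<le> 2 ^ n \<and> real k / 2 ^ n \<le> t}"
    using A(2,3) by (meson atLeastAtMost_iff cSup_upper order_trans subsetD)
  moreover have "Sup {dyadic_val x n k | n k. k \<le> 2 ^ n \<and> real k / 2 ^ n \<le> t} \<le> 1"
    by (intro cSup_least A(1)) (use dyadic_val_range in fastforce)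
  ultimately show ?thesis by (simp add: dyadic_extension_def)
qed

lemma dyadic_extension_mono:
  assumes "0 \<le> s" "s \<le> t"
  shows "dyadic_extension x s \<le> dyadic_extension x t"
  unfolding dyadic_extension_def
proof (rule cSup_subset_mono)
  show "{dyadic_val x n k | n k. k \<le> 2 ^ n \<and> real k / 2 ^ n \<le> s}
    \<subseteq> {dyadic_val x n k | n k. k \<le> 2 ^ n \<and> real k / 2 ^ n \<le> t}"
    using assms(2) by (blast intro: order_trans)
qed (use assms extension_set(1)[of s] extension_set(3)[of t] in auto)

lemma dyadic_extension_dyadic:
  assumes "k \<le> 2 ^ n"
  shows "dyadic_extension x (real k / 2 ^ n) = dyadic_val x n k"
  unfolding dyadic_extension_def
proof (rule cSup_eq_maximum)
  show "dyadic_val x n k \<in> {dyadic_val x n' k' | n' k'. k' \<le> 2 ^ n' \<and> real k' / 2 ^ n' \<le> real k / 2 ^ n}"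
    using assms by blast
  fix y assume "y \<in> {dyadic_val x n' k' | n' k'. k' \<le> 2 ^ n' \<and> real k' / 2 ^ n' \<le> real k / 2 ^ n}"
  then obtain n' k' where y: "y = dyadic_val x n' k'" "k' \<le> 2 ^ n'" "real k' / 2 ^ n' \<le> real k / 2 ^ n"
    by blast
  have "real (k' * 2 ^ n) \<le> real (k * 2 ^ n')" using y(3) by (simp add: field_simps)
  then have "k' * 2 ^ n \<le> k * 2 ^ n'" by (simp only: of_nat_le_iff)
  moreover have "k * 2 ^ n' \<le> 2 ^ (n + n')" using assms by (simp add: power_add)
  ultimately have "dyadic_val x (n + n') (k' * 2 ^ n) \<le> dyadic_val x (n + n') (k * 2 ^ n')"
    using ratio by (intro dyadic_val_mono) auto
  then show "y \<le> dyadic_val x n k"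
    using dyadic_val_level[of x n' n k'] by (simp add: y dyadic_val_level add.commute)
qed

lemma set_borel_measurable_comp_extension:
  fixes f :: "real \<Rightarrow> real"
  assumes "f \<in> borel_measurable borel"
  shows "set_borel_measurable lborel {0..1} (f \<circ> dyadic_extension x)"
proof -
  have "mono_on {0..1} (dyadic_extension x)"
    by (intro mono_onI dyadic_extension_mono) auto
  then have "dyadic_extension x \<in> borel_measurable (restrict_space borel {0..1})"
    by (rule borel_measurable_mono_on_fnc)
  then have "f \<circ> dyadic_extension x \<in> borel_measurable (restrict_space borel {0..1})"
    using assms by (rule measurable_comp)
  then show ?thesis
    using borel_measurable_restrict_space_iff[of "{0..1}" "borel :: real measure" "f \<circ> dyadic_extension x"]
    by (simp add: set_borel_measurable_def)
qed

lemma left_edge_le: "n \<le> m \<Longrightarrow> dyadic_val x m 1 \<le> dyadic_val x n 1"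
proof (induction m rule: dec_induct)
  case (step m)
  have "x (Suc m) 1 \<in> {0..1}" using one_less_power[of "2::nat" "Suc m"] by (intro ratio) (simp add: dyadic_index_def)
  then have "x (Suc m) 1 * dyadic_val x m 1 \<le> 1 * dyadic_val x m 1"
    using dyadic_val_range[of 1 m] by (intro mult_right_mono) auto
  then show ?case using step.IH by (simp add: dyadic_val_Suc_1 del: dyadic_val.simps(2) One_nat_def)
qed simp

text \<open>Every ratio of at most \<open>1 / 2\<close> on the left edge at least halves the value,
  and no ratio increases it.\<close>

lemma left_edge_tendsto_0:
  assumes half: "\<And>m. \<exists>n>m. x n 1 \<le> 1 / 2"
  shows "(\<lambda>n. dyadic_val x n 1) \<longlonglongrightarrow> 0"
proof -
  have *: "\<exists>n. dyadic_val x n 1 \<le> (1 / 2) ^ r" for r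
  proof (induction r)
    case 0
    then show ?case using dyadic_val_range[of 1 0] by (intro exI[of _ 0]) auto
  next
    case (Suc r)
    then obtain n where n: "dyadic_val x n 1 \<le> (1 / 2) ^ r" by blast
    obtain m where m: "m > n" "x m 1 \<le> 1 / 2" using half by blast
    then obtain m' where m': "m = Suc m'" "n \<le> m'" by (cases m) auto
    have "dyadic_val x m' 1 \<le> (1 / 2) ^ r" using left_edge_le[OF m'(2)] n by linarith
    then have "x m 1 * dyadic_val x m' 1 \<le> 1 / 2 * (1 / 2) ^ r"
      using m dyadic_val_range[of 1 m'] by (intro mult_mono) auto
    then show ?case by (intro exI[of _ m]) (simp add: m' dyadic_val_Suc_1 del: dyadic_val.simps(2) One_nat_def)
  qed
  show ?thesis
  proof (rule LIMSEQ_I)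
    fix e :: real assume "e > 0"
    then obtain r where r: "(1 / 2) ^ r < e" using real_arch_pow_inv[of e "1 / 2"] by auto
    obtain n where n: "dyadic_val x n 1 \<le> (1 / 2) ^ r" using * by blast
    have "norm (dyadic_val x m 1 - 0) < e" if "m \<ge> n" for m
      using left_edge_le[OF that] n r dyadic_val_range[of 1 m] by auto
    then show "\<exists>n. \<forall>m\<ge>n. norm (dyadic_val x m 1 - 0) < e" by blast
  qed
qed

lemma dyadic_extension_le_left_edge:
  assumes "0 \<le> t" "t \<le> 1 / 2 ^ q"
  shows "dyadic_extension x t \<le> dyadic_val x q 1"
  using dyadic_extension_mono[OF assms] dyadic_extension_dyadic[of 1 q] by simp

text \<open>\<open>half\<close> brings the values at the left end to \<open>0\<close>. At the right
  end a single ratio of at least \<open>1 / 2\<close> lifts the value at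
  \<open>1 - 1 / 2 ^ n\<close> to at least \<open>1 / 2\<close>, and \<open>periodic_osc\<close>
  vanishes on \<open>{1 / 2..1}\<close>.\<close>

lemma bounded_at_circle_comp:
  assumes half: "\<And>m. \<exists>n>m. x n 1 \<le> 1 / 2"
    and right: "n \<ge> 1" "1 / 2 \<le> x n (2 ^ n - 1)"
  shows "bounded_at_circle (periodic_osc \<circ> dyadic_extension x) (1 - 1 / 2 ^ n)"
proof
  show "set_borel_measurable lborel {0..1} (periodic_osc \<circ> dyadic_extension x)"
    using continuous_periodic_osc by (intro set_borel_measurable_comp_extension borel_measurable_continuous_onI)
  show "\<bar>(periodic_osc \<circ> dyadic_extension x) t\<bar> \<le> 1" for t
    using periodic_osc_range by simp
  have "(1::real) / 2 ^ n \<le> 1 / 2 ^ 1" using right(1) by (intro divide_left_mono power_increasing) auto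
  then show "1 / 2 \<le> 1 - 1 / (2::real) ^ n" by simp
  show "1 - 1 / 2 ^ n < (1::real)" by simp
  obtain n' where n: "n = Suc n'" using right(1) by (cases n) auto
  define k where "k = (2::nat) ^ n' - 1"
  have k: "2 ^ n' = Suc k" by (simp add: k_def)
  then have k': "2 ^ n - 1 = Suc (2 * k)" by (simp add: n)
  have "dyadic_val x n (2 ^ n - 1) = dyadic_val x n' k + x n (2 ^ n - 1) * (1 - dyadic_val x n' k)"
    using dyadic_val_top[of x n'] by (simp add: n k k'[unfolded n])
  moreover have "dyadic_val x n' k \<in> {0..1}" by (rule dyadic_val_range) (simp add: k)
  moreover have "1 / 2 * (1 - dyadic_val x n' k) \<le> x n (2 ^ n - 1) * (1 - dyadic_val x n' k)"
    using right(2) calculation(2) by (intro mult_right_mono) auto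
  ultimately have "1 / 2 \<le> dyadic_val x n (2 ^ n - 1)" by (simp only: atLeastAtMost_iff) argo
  then have edge: "1 / 2 \<le> dyadic_extension x (1 - 1 / 2 ^ n)"
    using dyadic_extension_dyadic[of "2 ^ n - 1" n] by (simp add: of_nat_diff diff_divide_distrib)
  show "(periodic_osc \<circ> dyadic_extension x) t = 0" if "t \<in> {1 - 1 / 2 ^ n..1}" for t
  proof -
    have "0 \<le> 1 - 1 / (2::real) ^ n" by simp
    moreover from this have "0 \<le> t" using that by (meson atLeastAtMost_iff order_trans)
    ultimately have "1 / 2 \<le> dyadic_extension x t" "dyadic_extension x t \<in> {0..1}"
      using that edge dyadic_extension_mono[of "1 - 1 / 2 ^ n" t] dyadic_extension_range[of t] by auto
    then show ?thesis using periodic_osc_eq_0 by auto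
  qed
  have lim: "(dyadic_extension x \<longlongrightarrow> 0) (at_right 0)"
  proof (rule tendstoI)
    fix e :: real assume "e > 0"
    then have "\<forall>\<^sub>F n in sequentially. dyadic_val x n 1 < e"
      using left_edge_tendsto_0[OF half] by (intro order_tendstoD)
    then obtain q where q: "dyadic_val x q 1 < e" by (auto simp: eventually_sequentially)
    have "\<forall>\<^sub>F t in at_right 0. t \<in> {0<..<1 / 2 ^ q :: real}"
      by (intro eventually_at_right_real) simp
    then show "\<forall>\<^sub>F t in at_right 0. dist (dyadic_extension x t) 0 < e"
    proof eventually_elim
      case (elim t)
      then have "dyadic_extension x t \<le> dyadic_val x q 1" "dyadic_extension x t \<in> {0..1}"
        by (intro dyadic_extension_le_left_edge dyadic_extension_range; simp)+
      then show ?case using q by auto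
    qed
  qed
  have "isCont periodic_osc 0"
    using continuous_periodic_osc by (rule continuous_on_interior) simp
  then have "((\<lambda>t. periodic_osc (dyadic_extension x t)) \<longlongrightarrow> periodic_osc 0) (at_right 0)"
    using lim by (rule isCont_tendsto_compose)
  then show "((periodic_osc \<circ> dyadic_extension x) \<longlongrightarrow> 0) (at_right 0)"
    by (simp add: periodic_osc_def osc_def comp_def)
qed

end

section \<open>Windows\<close>

text \<open>The ratios for which the dyadic values on level \<open>m\<close> are \<open>F\<close>. Where \<open>F\<close> is flat the quotient is
  \<open>0 / 0 = 0\<close>, which still gives the right value.\<close>

definition target_ratio :: "(nat \<Rightarrow> real) \<Rightarrow> nat \<Rightarrow> nat \<Rightarrow> nat \<Rightarrow> real" where
  "target_ratio F m s j = (F (j * 2 ^ (m - s)) - F ((j - 1) * 2 ^ (m - s)))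
    / (F ((j + 1) * 2 ^ (m - s)) - F ((j - 1) * 2 ^ (m - s)))"

lemma target_ratio_range:
  assumes "mono F"
  shows "target_ratio F m s j \<in> {0..1}"
proof -
  have "F ((j - 1) * 2 ^ (m - s)) \<le> F (j * 2 ^ (m - s))" "F (j * 2 ^ (m - s)) \<le> F ((j + 1) * 2 ^ (m - s))"
    by (intro monoD[OF assms] mult_le_mono; simp)+
  then show ?thesis by (auto simp: target_ratio_def divide_le_eq_1)
qed

lemma dyadic_val_target_ratio:
  assumes F: "mono F" "F 0 = 0" "F (2 ^ m) = 1" and "s \<le> m" "j \<le> 2 ^ s"
  shows "dyadic_val (target_ratio F m) s j = F (j * 2 ^ (m - s))"
  using assms(4,5)
proof (induction s arbitrary: j)
  case 0
  then have "j = 0 \<or> j = 1" by auto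
  then show ?case using F by auto
next
  case (Suc s)
  define h where "h = (2::nat) ^ (m - Suc s)"
  have h: "2 ^ (m - s) = 2 * h" using Suc.prems by (simp add: h_def Suc_diff_Suc flip: power_Suc)
  show ?case
  proof (cases "even j")
    case True
    then obtain i where j: "j = 2 * i" by blast
    then show ?thesis using Suc by (simp add: h h_def[symmetric] mult.assoc mult.left_commute)
  next
    case False
    then obtain i where j: "j = 2 * i + 1" by (blast elim: oddE)
    have "2 * i + 1 \<le> 2 * 2 ^ s" using Suc.prems j by simp
    then have "i + 1 \<le> 2 ^ s" by linarith
    then have IH: "dyadic_val (target_ratio F m) s (i + 1) = F ((2 * i + 2) * h)"
      "dyadic_val (target_ratio F m) s i = F (2 * i * h)"
      using Suc.IH[of "i + 1"] Suc.IH[of i] Suc.prems by (simp_all add: h algebra_simps)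
    have "F (2 * i * h) \<le> F ((2 * i + 1) * h)" "F ((2 * i + 1) * h) \<le> F ((2 * i + 2) * h)"
      by (intro monoD[OF F(1)] mult_le_mono; simp)+
    then have "F (2 * i * h) + target_ratio F m (Suc s) j * (F ((2 * i + 2) * h) - F (2 * i * h)) = F ((2 * i + 1) * h)"
      by (simp add: target_ratio_def h_def[symmetric] j)
    then show ?thesis using IH by (simp add: j h_def[symmetric])
  qed
qed

text \<open>In one step the old errors enter with the weights \<open>1 - p\<close> and
  \<open>p\<close>, and the error of the new ratio is multiplied by a length of at most
  \<open>1\<close>. So each level costs one \<open>\<eta>\<close>.\<close>

lemma dyadic_val_perturb:
  assumes y: "\<And>s j. (s, j) \<in> dyadic_index \<Longrightarrow> y s j \<in> {0..1}"
    and r: "\<And>s j. (s, j) \<in> dyadic_index \<Longrightarrow> r s j \<in> {0..1}"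
    and close: "\<And>s j. s \<le> m \<Longrightarrow> (s, j) \<in> dyadic_index \<Longrightarrow> \<bar>y s j - r s j\<bar> \<le> \<eta>"
    and "0 \<le> \<eta>" "s \<le> m" "j \<le> 2 ^ s"
  shows "\<bar>dyadic_val y s j - dyadic_val r s j\<bar> \<le> real s * \<eta>"
  using assms(5,6)
proof (induction s arbitrary: j)
  case (Suc s)
  have le: "real s * \<eta> \<le> real (Suc s) * \<eta>" using \<open>0 \<le> \<eta>\<close> by (intro mult_right_mono) auto
  show ?case
  proof (cases "even j")
    case True
    have "\<bar>dyadic_val y s (j div 2) - dyadic_val r s (j div 2)\<bar> \<le> real s * \<eta>"
      using Suc by auto
    then show ?thesis using True le by simp
  next
    case False
    then obtain i where j: "j = 2 * i + 1" by (blast elim: oddE)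
    have "2 * i + 1 \<le> 2 * 2 ^ s" using Suc.prems j by simp
    then have i: "i + 1 \<le> 2 ^ s" by linarith
    define a b a' b' where "a = dyadic_val r s i" and "b = dyadic_val r s (i + 1)"
      and "a' = dyadic_val y s i" and "b' = dyadic_val y s (i + 1)"
    have ab': "\<bar>a' - a\<bar> \<le> real s * \<eta>" "\<bar>b' - b\<bar> \<le> real s * \<eta>"
      unfolding a_def b_def a'_def b'_def using Suc.IH[of i] Suc.IH[of "i + 1"] Suc.prems i by auto
    interpret R: splitting_ratios r by standard (rule r)
    have "a \<in> {0..1}" "b \<in> {0..1}"
      unfolding a_def b_def using i by (intro R.dyadic_val_range; simp)+
    then have ab: "\<bar>b - a\<bar> \<le> 1" by auto
    have mem: "(Suc s, j) \<in> dyadic_index" using Suc.prems False j i by (auto simp: dyadic_index_def)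
    define p q where "p = y (Suc s) j" and "q = r (Suc s) j"
    have p: "0 \<le> p" "p \<le> 1" using y[OF mem] by (auto simp: p_def)
    have pq: "\<bar>p - q\<bar> \<le> \<eta>" using close[OF _ mem] Suc.prems by (simp add: p_def q_def)
    have "dyadic_val y (Suc s) j - dyadic_val r (Suc s) j = (1 - p) * (a' - a) + p * (b' - b) + (p - q) * (b - a)"
      by (simp add: j a_def b_def a'_def b'_def p_def q_def algebra_simps)
    also have "\<bar>\<dots>\<bar> \<le> \<bar>(1 - p) * (a' - a)\<bar> + \<bar>p * (b' - b)\<bar> + \<bar>(p - q) * (b - a)\<bar>"
      by linarith
    also have "\<dots> = (1 - p) * \<bar>a' - a\<bar> + p * \<bar>b' - b\<bar> + \<bar>p - q\<bar> * \<bar>b - a\<bar>"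
      using p by (simp add: abs_mult)
    also have "\<dots> \<le> (1 - p) * (real s * \<eta>) + p * (real s * \<eta>) + \<eta> * 1"
      using ab ab' p pq \<open>0 \<le> \<eta>\<close> by (intro add_mono mult_left_mono mult_mono) auto
    finally show ?thesis by (simp add: algebra_simps)
  qed
qed simp

text \<open>Quarter turns: four of them suffice to align the staircase with an arbitrary argument of
  the cosine, see \<open>exists_phase\<close>.\<close>

definition phase :: "nat \<Rightarrow> real" where
  "phase c = real c * (pi / 2)"

text \<open>The level is \<open>2 * i\<close> on \<open>{8 * i + 1..8 * i + 3}\<close> and \<open>2 * i + 1\<close> on \<open>{8 * i + 4..8 * i + 8}\<close>.
  Raising it by one turns the sign of the cosine in \<open>osc\<close>. At \<open>0\<close> it is a truncated subtraction.\<close>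

definition staircase_level :: "nat \<Rightarrow> nat" where
  "staircase_level j = (j + 4) div 8 + (j + 7) div 8 - 1"

text \<open>Each level multiplies the value by \<open>exp pi\<close>, half a period of the cosine of
  the logarithm. For \<open>m \<ge> 3\<close> the number \<open>2 ^ (m - 2)\<close> is even, so
  subtracting it keeps the stairs below \<open>1\<close> without changing any sign. The end values
  \<open>0\<close> and \<open>1\<close> are those that \<open>dyadic_val_target_ratio\<close> asks
  for.\<close>

definition staircase :: "nat \<Rightarrow> nat \<Rightarrow> nat \<Rightarrow> real" where
  "staircase c m j = (if j = 0 then 0 else if 2 ^ m \<le> j then 1
    else exp (pi * (real (staircase_level j) - 2 ^ (m - 2)) - phase c))"

text \<open>Small enough that \<open>m\<close> such errors stay below one percent of the lowest
  stair, which is at least \<open>exp (- (2 ^ m) - 6)\<close>: see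
  \<open>tolerance_small\<close>.\<close>

definition tolerance :: "nat \<Rightarrow> real" where
  "tolerance m = (1 / 4) ^ (10 * 2 ^ m)"

lemma staircase_level_mono: "j \<le> k \<Longrightarrow> staircase_level j \<le> staircase_level k"
  unfolding staircase_level_def by (intro diff_le_mono add_mono div_le_mono) auto

lemma staircase_level_less:
  assumes "3 \<le> m" "j < 2 ^ m"
  shows "staircase_level j < 2 ^ (m - 2)"
proof -
  obtain r where m: "m = r + 3" using assms(1) by (metis add.commute le_Suc_ex)
  define Y where "Y = (2::nat) ^ r"
  have Y: "2 ^ m = 8 * Y" "2 ^ (m - 2) = 2 * Y" "0 < Y"
    by (simp_all add: m Y_def power_add)
  have "j < 8 * Y" using assms(2) Y(1) by simp
  then have "j + 4 < 8 * (Y + 1)" "j + 7 < 8 * (Y + 1)" by simp_all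
  then have "(j + 4) div 8 < Y + 1" "(j + 7) div 8 < Y + 1"
    by (simp_all only: div_less_iff_less_mult zero_less_numeral mult.commute)
  then show ?thesis unfolding staircase_level_def Y(2) using Y(3) by linarith
qed

lemma staircase_le_1:
  assumes "3 \<le> m"
  shows "staircase c m j \<le> 1"
proof -
  have "pi * (real (staircase_level j) - 2 ^ (m - 2)) - phase c \<le> 0" if "j < 2 ^ m"
  proof -
    have "real (staircase_level j) \<le> real (2 ^ (m - 2))"
      using staircase_level_less[OF assms that] by (simp only: of_nat_le_iff)
    then have "pi * (real (staircase_level j) - 2 ^ (m - 2)) \<le> 0" by (intro mult_nonneg_nonpos) auto
    moreover have "0 \<le> phase c" by (simp add: phase_def)
    ultimately show ?thesis by linarith
  qed
  then show ?thesis by (simp add: staircase_def)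
qed

lemma staircase_mono:
  assumes "3 \<le> m"
  shows "mono (staircase c m)"
proof (rule monoI)
  fix j k :: nat assume "j \<le> k"
  show "staircase c m j \<le> staircase c m k"
  proof (cases "j = 0 \<or> 2 ^ m \<le> k")
    case True
    then show ?thesis using staircase_le_1[OF assms, of c j] \<open>j \<le> k\<close> by (auto simp: staircase_def)
  next
    case False
    then show ?thesis using staircase_level_mono[OF \<open>j \<le> k\<close>] \<open>j \<le> k\<close>
      by (auto simp: staircase_def)
  qed
qed

text \<open>For fixed \<open>c\<close> the phase condition concerns the levels up to
  \<open>q\<close> and the closeness condition the \<open>m\<close> levels after them; the
  probabilistic part rests on this separation.\<close>

definition window_good :: "nat \<Rightarrow> nat \<Rightarrow> (nat \<Rightarrow> nat \<Rightarrow> real) \<Rightarrow> bool" where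
  "window_good m q x \<longleftrightarrow> (\<exists>c<4. 7 / 10 \<le> cos (ln (dyadic_val x q 1) - phase c) \<and>
    (\<forall>s j. s \<le> m \<longrightarrow> (s, j) \<in> dyadic_index \<longrightarrow>
      \<bar>x (q + s) j - target_ratio (staircase c m) m s j\<bar> \<le> tolerance m))"

lemma shift_index:
  assumes "(s, j) \<in> dyadic_index"
  shows "(q + s, j) \<in> dyadic_index"
proof -
  have "(2::nat) ^ s \<le> 2 ^ (q + s)" by (intro power_increasing) auto
  then show ?thesis using assms by (auto simp: dyadic_index_def intro: less_le_trans)
qed

lemma abs_cos_diff_le: "\<bar>cos a - cos b\<bar> \<le> \<bar>a - b\<bar>" for a b :: real
proof -
  have "\<bar>cos a - cos b\<bar> = 2 * (\<bar>sin ((a + b) / 2)\<bar> * \<bar>sin ((b - a) / 2)\<bar>)"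
    by (simp add: cos_diff_cos abs_mult)
  also have "\<dots> \<le> 2 * (1 * \<bar>(b - a) / 2\<bar>)"
    by (intro mult_left_mono mult_mono abs_sin_x_le_abs_x) auto
  finally show ?thesis by simp
qed

lemma cos_add_nat_pi: "cos (v + pi * real n) = (- 1) ^ n * cos v"
  by (simp add: cos_add)

text \<open>The four cosines are \<open>cos u\<close>, \<open>sin u\<close> and their negatives; the
  larger of the two squares is at least \<open>1 / 2\<close>, which exceeds
  \<open>(7 / 10)\<^sup>2\<close>.\<close>

lemma exists_phase: "\<exists>c<4. 7 / 10 \<le> cos (u - phase c)"
proof (rule ccontr)
  assume "\<not> ?thesis"
  then have *: "cos (u - phase c) < 7 / 10" if "c < 4" for c using that by force
  have phases: "cos (u - phase 0) = cos u" "cos (u - phase 1) = sin u" "cos (u - phase 2) = - cos u"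
    by (simp_all add: phase_def cos_diff)
  have "phase 3 = pi + pi / 2" by (simp add: phase_def)
  moreover have "cos (u - (pi + pi / 2)) = - sin u"
    unfolding cos_diff sin_add cos_add by simp
  ultimately have "cos (u - phase 3) = - sin u" by metis
  then have "\<bar>cos u\<bar> < 7 / 10" "\<bar>sin u\<bar> < 7 / 10"
    using phases *[of 0] *[of 1] *[of 2] *[of 3] by (auto simp: abs_less_iff)
  then have "\<bar>cos u\<bar>\<^sup>2 < (7 / 10)\<^sup>2" "\<bar>sin u\<bar>\<^sup>2 < (7 / 10)\<^sup>2"
    by (intro power_strict_mono; simp)+
  then show False using sin_cos_squared_add[of u] by (simp add: power2_eq_square)
qed

lemma abs_ln_ratio_le:
  fixes w E :: real
  assumes "0 < E" "\<bar>w - E\<bar> \<le> E / 100"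
  shows "0 < w" "\<bar>ln w - ln E\<bar> \<le> 1 / 50"
proof -
  have w: "99 / 100 * E \<le> w" "w \<le> 101 / 100 * E" using assms(2) by linarith+
  then show "0 < w" using assms by linarith
  then have "ln w - ln E = ln (w / E)" "ln E - ln w = ln (E / w)" using assms by (simp_all add: ln_div)
  moreover have "ln (w / E) \<le> w / E - 1" "ln (E / w) \<le> E / w - 1"
    using assms \<open>0 < w\<close> by (intro ln_le_minus_one; simp)+
  moreover have "w / E - 1 \<le> 1 / 50" "E / w - 1 \<le> 1 / 50"
    using w assms \<open>0 < w\<close> by (simp_all add: divide_le_eq diff_le_eq)
  ultimately show "\<bar>ln w - ln E\<bar> \<le> 1 / 50" by (simp only: abs_le_iff) linarith
qed

lemma phase_bounds:
  assumes "c < 4"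
  shows "0 \<le> phase c" "phase c \<le> 6"
proof -
  show "0 \<le> phase c" by (simp add: phase_def)
  have "real c * (pi / 2) \<le> 3 * (4 / 2)" using assms pi_less_4 by (intro mult_mono) auto
  then show "phase c \<le> 6" by (simp add: phase_def)
qed

lemma staircase_ge:
  assumes "3 \<le> m" "c < 4"
  shows "- (2 ^ m) - 6 \<le> pi * (real e - 2 ^ (m - 2)) - phase c"
proof -
  have "pi * 2 ^ (m - 2) \<le> 4 * 2 ^ (m - 2)" using pi_less_4 by (intro mult_right_mono) auto
  also have "4 * 2 ^ (m - 2) = (2::real) ^ (2 + (m - 2))" by (simp add: power_add)
  also have "2 + (m - 2) = m" using assms by simp
  finally have "pi * 2 ^ (m - 2) \<le> 2 ^ m" .
  moreover have "0 \<le> pi * real e" by simp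
  ultimately show ?thesis using phase_bounds[OF assms(2)] unfolding right_diff_distrib by linarith
qed

lemma tolerance_small:
  assumes "3 \<le> m" "c < 4"
  shows "real m * tolerance m \<le> exp (pi * (real e - 2 ^ (m - 2)) - phase c) / 100"
proof -
  define N where "N = (2::nat) ^ m"
  have "(2::nat) ^ 3 \<le> N" unfolding N_def using assms by (intro power_increasing) auto
  then have N: "8 \<le> N" by simp
  have "real m \<le> real N" unfolding N_def by (simp add: less_imp_le)
  also have "real N \<le> 4 ^ N"
  proof -
    have "N < 4 ^ N" by (rule less_exp[THEN less_le_trans]) (intro power_mono; simp)
    then have "real N \<le> real (4 ^ N)" by (simp only: of_nat_le_iff)
    then show ?thesis by simp
  qed
  finally have m: "real m \<le> 4 ^ N" .
  have tol: "tolerance m = 1 / 4 ^ (10 * N)" by (simp add: tolerance_def N_def power_one_over)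
  have "exp (real (N + 6)) = exp 1 ^ (N + 6)" by (simp add: exp_of_nat_mult[symmetric])
  also have "\<dots> \<le> 4 ^ (N + 6)" using exp_le by (intro power_mono) auto
  finally have "1 / 4 ^ (N + 6) \<le> 1 / exp (real (N + 6))"
    by (intro divide_left_mono) auto
  also have "\<dots> = exp (- (2 ^ m) - 6)"
    by (simp add: N_def exp_diff exp_add exp_minus field_simps)
  also have "\<dots> \<le> exp (pi * (real e - 2 ^ (m - 2)) - phase c)"
    using staircase_ge[OF assms] by simp
  finally have E: "1 / 4 ^ (N + 6) \<le> exp (pi * (real e - 2 ^ (m - 2)) - phase c)" .
  have "100 * (real m * tolerance m) \<le> 4 ^ 4 * (4 ^ N * (1 / 4 ^ (10 * N)))"
    unfolding tol using m by (intro mult_mono mult_right_mono) auto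
  also have "\<dots> = 4 ^ (4 + N) / 4 ^ (10 * N)" by (simp add: power_add)
  also have "\<dots> \<le> 1 / 4 ^ (N + 6)"
  proof -
    have "(4::real) ^ (4 + N) * 4 ^ (N + 6) \<le> 4 ^ (10 * N)"
      unfolding power_add[symmetric] using N by (intro power_increasing) auto
    then show ?thesis by (simp add: field_simps)
  qed
  finally show ?thesis using E by simp
qed

section \<open>The composed function on a good window\<close>

context splitting_ratios
begin

lemma window_dyadic_val:
  assumes m: "3 \<le> m" and c: "c < 4" and j: "0 < j" "j < 2 ^ m"
    and close: "\<And>s j. s \<le> m \<Longrightarrow> (s, j) \<in> dyadic_index \<Longrightarrow>
      \<bar>x (q + s) j - target_ratio (staircase c m) m s j\<bar> \<le> tolerance m"
  shows "\<bar>dyadic_val (\<lambda>s j. x (q + s) j) m j - exp (pi * (real (staircase_level j) - 2 ^ (m - 2)) - phase c)\<bar>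
    \<le> exp (pi * (real (staircase_level j) - 2 ^ (m - 2)) - phase c) / 100"
proof -
  note mono = staircase_mono[OF m, of c]
  have "\<bar>dyadic_val (\<lambda>s j. x (q + s) j) m j - dyadic_val (target_ratio (staircase c m) m) m j\<bar>
      \<le> real m * tolerance m"
    using j close
    by (intro dyadic_val_perturb[where m = m] ratio shift_index target_ratio_range mono) (auto simp: tolerance_def)
  moreover have "dyadic_val (target_ratio (staircase c m) m) m j = staircase c m j"
    using dyadic_val_target_ratio[OF mono, of m m j] j by (simp add: staircase_def)
  ultimately show ?thesis
    using tolerance_small[OF m c, of "staircase_level j"] j by (simp add: staircase_def)
qed

text \<open>Both ends of a run of grid points on one stair carry values within one percent of that
  stair, and monotonicity traps the extension at every \<open>t\<close> in between.\<close>

lemma window_cell: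
  assumes m: "3 \<le> m" and c: "c < 4" and z: "0 < dyadic_val x q 1"
    and close: "\<And>s j. s \<le> m \<Longrightarrow> (s, j) \<in> dyadic_index \<Longrightarrow>
      \<bar>x (q + s) j - target_ratio (staircase c m) m s j\<bar> \<le> tolerance m"
    and jk: "0 < j" "j \<le> k" "k < 2 ^ m"
    and level: "staircase_level j = e" "staircase_level k = e"
    and t: "real j \<le> 2 ^ (q + m) * t" "2 ^ (q + m) * t \<le> real k"
  shows "0 < dyadic_extension x t"
    and "\<bar>ln (dyadic_extension x t) - (ln (dyadic_val x q 1) + (pi * (real e - 2 ^ (m - 2)) - phase c))\<bar> \<le> 1 / 50"
    and "dyadic_extension x t \<le> dyadic_val x q 1"
proof -
  define E where "E = exp (pi * (real e - 2 ^ (m - 2)) - phase c)"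
  define z where "z = dyadic_val x q 1"
  define w where "w = dyadic_extension x t / z"
  have ext: "dyadic_extension x (real i / 2 ^ (q + m)) = z * dyadic_val (\<lambda>s j. x (q + s) j) m i"
    if "i \<le> 2 ^ m" for i
  proof -
    have "(2::nat) ^ m \<le> 2 ^ (q + m)" by (intro power_increasing) auto
    then have "i \<le> 2 ^ (q + m)" using that by (rule order_trans[rotated])
    then show ?thesis using that dyadic_extension_dyadic[of i "q + m"] dyadic_val_subtree[of i m x q]
      by (simp add: z_def)
  qed
  have tj: "real j / 2 ^ (q + m) \<le> t" "t \<le> real k / 2 ^ (q + m)"
    using t by (simp_all add: divide_le_eq le_divide_eq mult.commute)
  have t0: "0 \<le> t" by (rule order_trans[OF _ tj(1)]) simp
  have "z * dyadic_val (\<lambda>s j. x (q + s) j) m j \<le> dyadic_extension x t"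
    using dyadic_extension_mono[OF _ tj(1)] ext[of j] jk by simp
  moreover have "dyadic_extension x t \<le> z * dyadic_val (\<lambda>s j. x (q + s) j) m k"
    using dyadic_extension_mono[OF t0 tj(2)] ext[of k] jk by simp
  ultimately have "dyadic_val (\<lambda>s j. x (q + s) j) m j \<le> w" "w \<le> dyadic_val (\<lambda>s j. x (q + s) j) m k"
    using z by (simp_all add: w_def z_def divide_le_eq le_divide_eq mult.commute)
  moreover have "\<bar>dyadic_val (\<lambda>s j. x (q + s) j) m j - E\<bar> \<le> E / 100" "\<bar>dyadic_val (\<lambda>s j. x (q + s) j) m k - E\<bar> \<le> E / 100"
    using window_dyadic_val[OF m c _ _ close, of j] window_dyadic_val[OF m c _ _ close, of k] jk level
    by (simp_all add: E_def)
  ultimately have "\<bar>w - E\<bar> \<le> E / 100" by linarith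
  then have w: "0 < w" "\<bar>ln w - ln E\<bar> \<le> 1 / 50"
    using abs_ln_ratio_le[of E w] by (auto simp: E_def)
  have ext_t: "dyadic_extension x t = z * w" using z by (simp add: w_def z_def)
  show "0 < dyadic_extension x t" using w z by (simp add: ext_t z_def)
  have "ln (dyadic_extension x t) = ln z + ln w" unfolding ext_t using w z by (intro ln_mult_pos) (auto simp: z_def)
  then show "\<bar>ln (dyadic_extension x t) - (ln (dyadic_val x q 1) + (pi * (real e - 2 ^ (m - 2)) - phase c))\<bar> \<le> 1 / 50"
    using w(2) by (simp add: E_def z_def)
  have "real k / 2 ^ (q + m) \<le> 1 / 2 ^ q"
  proof -
    have "real k \<le> real (2 ^ m)" using jk(3) by (simp only: of_nat_le_iff less_imp_le)
    then show ?thesis by (simp add: power_add divide_le_eq)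
  qed
  then show "dyadic_extension x t \<le> dyadic_val x q 1"
    using tj t0 by (intro dyadic_extension_le_left_edge) auto
qed

text \<open>A period of the sine consists of eight grid steps of level \<open>q + m\<close>: steps 4
  to 8 lie on an odd stair and steps 1 to 3 on an even one. The margin
  \<open>7 / 10 - 1 / 50\<close> exceeds the thresholds of \<open>hump\<close> at cosine
  \<open>1 / 2\<close> and \<open>- 1 / 2\<close>. The bound \<open>B\<close> on the depth controls
  the amplitude.\<close>

lemma window:
  assumes m: "4 \<le> m" and z: "0 < dyadic_val x q 1" "dyadic_val x q 1 < osc_end"
    and good: "window_good m q x"
    and depth: "- ln (dyadic_val x q 1) \<le> B" "ln (ln (B + 2 ^ m + 7)) \<le> 6 * real m"
    and i: "i < 2 ^ (m - 4)"
  shows "real i + 1 / 2 \<le> 2 ^ (q + m - 3) * t \<Longrightarrow> 2 ^ (q + m - 3) * t \<le> real i + 1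
      \<Longrightarrow> periodic_osc (dyadic_extension x t) = 0"
    and "real i + 1 / 8 \<le> 2 ^ (q + m - 3) * t \<Longrightarrow> 2 ^ (q + m - 3) * t \<le> real i + 3 / 8
      \<Longrightarrow> 1 / (6 * real m) \<le> periodic_osc (dyadic_extension x t)"
proof -
  obtain c where c: "c < 4" "7 / 10 \<le> cos (ln (dyadic_val x q 1) - phase c)"
    and close: "\<And>s j. s \<le> m \<Longrightarrow> (s, j) \<in> dyadic_index \<Longrightarrow>
      \<bar>x (q + s) j - target_ratio (staircase c m) m s j\<bar> \<le> tolerance m"
    using good unfolding window_good_def by blast
  have m3: "3 \<le> m" using m by simp
  define u where "u = dyadic_extension x t"
  have scale: "2 ^ (q + m) * t = 8 * (2 ^ (q + m - 3) * t)"
  proof -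
    have "q + m = 3 + (q + m - 3)" using m by simp
    then have "(2::real) ^ (q + m) = 2 ^ 3 * 2 ^ (q + m - 3)" by (metis power_add)
    then show ?thesis by simp
  qed
  \<comment> \<open>The periods in question fill only the left half of the window, away from the
    index \<open>2 ^ m\<close> where the staircase is forced to \<open>1\<close>.\<close>
  have i8: "8 * i + 8 < 2 ^ m"
  proof -
    have "(2::nat) ^ m = 2 ^ 4 * 2 ^ (m - 4)" using m unfolding power_add[symmetric] by simp
    then show ?thesis using i by simp
  qed
  note cell = window_cell[OF m3 c(1) z(1) close]
  have cos_shift: "cos (ln (dyadic_val x q 1) + (pi * (real e - 2 ^ (m - 2)) - phase c))
      = (- 1) ^ e * cos (ln (dyadic_val x q 1) - phase c)" for e
  proof -
    define v where "v = ln (dyadic_val x q 1) + (pi * (real e - 2 ^ (m - 2)) - phase c)"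
    have "cos (v + pi * real (2 ^ (m - 2))) = (- 1) ^ 2 ^ (m - 2) * cos v" by (rule cos_add_nat_pi)
    also have "\<dots> = cos v" using m by simp
    also have "v + pi * real (2 ^ (m - 2)) = (ln (dyadic_val x q 1) - phase c) + pi * real e"
      by (simp add: v_def algebra_simps)
    finally show ?thesis by (simp add: cos_add_nat_pi v_def)
  qed
  have osc: "periodic_osc u = hump (ln u) / ln (ln (ln (1 / u)))" if "0 < u" "u \<le> dyadic_val x q 1"
    using that z osc_end_bounds by (subst periodic_osc_eq_osc) (auto simp: osc_def)
  show "periodic_osc (dyadic_extension x t) = 0"
    if "real i + 1 / 2 \<le> 2 ^ (q + m - 3) * t" "2 ^ (q + m - 3) * t \<le> real i + 1"
  proof -
    have t: "real (8 * i + 4) \<le> 2 ^ (q + m) * t" "2 ^ (q + m) * t \<le> real (8 * i + 8)"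
      using that unfolding scale by simp_all
    have level: "staircase_level (8 * i + 4) = 2 * i + 1" "staircase_level (8 * i + 8) = 2 * i + 1"
      by (simp_all add: staircase_level_def)
    have u: "0 < u" "u \<le> dyadic_val x q 1"
      "\<bar>ln u - (ln (dyadic_val x q 1) + (pi * (real (2 * i + 1) - 2 ^ (m - 2)) - phase c))\<bar> \<le> 1 / 50"
      unfolding u_def using cell[OF _ _ _ _ _ level t] i8 by simp_all
    have "\<bar>cos (ln u) + cos (ln (dyadic_val x q 1) - phase c)\<bar> \<le> 1 / 50"
      using order_trans[OF abs_cos_diff_le u(3)] unfolding cos_shift[of "2 * i + 1"] by simp
    then have "cos (ln u) \<le> - (7 / 10) + 1 / 50" using c(2) by linarith
    then have "hump (ln u) = 0" by (intro hump_eq_0) simp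
    then show ?thesis using osc u unfolding u_def by simp
  qed
  show "1 / (6 * real m) \<le> periodic_osc (dyadic_extension x t)"
    if "real i + 1 / 8 \<le> 2 ^ (q + m - 3) * t" "2 ^ (q + m - 3) * t \<le> real i + 3 / 8"
  proof -
    have t: "real (8 * i + 1) \<le> 2 ^ (q + m) * t" "2 ^ (q + m) * t \<le> real (8 * i + 3)"
      using that unfolding scale by simp_all
    have level: "staircase_level (8 * i + 1) = 2 * i" "staircase_level (8 * i + 3) = 2 * i"
      by (simp_all add: staircase_level_def)
    have u: "0 < u" "u \<le> dyadic_val x q 1"
      "\<bar>ln u - (ln (dyadic_val x q 1) + (pi * (real (2 * i) - 2 ^ (m - 2)) - phase c))\<bar> \<le> 1 / 50"
      unfolding u_def using cell[OF _ _ _ _ _ level t] i8 by simp_all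
    have "\<bar>cos (ln u) - cos (ln (dyadic_val x q 1) - phase c)\<bar> \<le> 1 / 50"
      using order_trans[OF abs_cos_diff_le u(3)] unfolding cos_shift[of "2 * i"] by simp
    then have "7 / 10 - 1 / 50 \<le> cos (ln u)" using c(2) by linarith
    then have hump: "hump (ln u) = 1" by (intro hump_eq_1) simp
    have lll: "27 \<le> ln (1 / u)" "1 \<le> ln (ln (ln (1 / u)))"
      using ln_ln_ln_ge_1[of u] u z by auto
    have "ln (1 / u) = - ln u" using u(1) by (simp add: ln_div)
    \<comment> \<open>\<open>2 ^ m + 6\<close> bounds the descent of the staircase, by
      \<open>staircase_ge\<close>; the error \<open>1 / 50\<close> is rounded up to
      \<open>1\<close>.\<close>
    then have "ln (1 / u) \<le> B + 2 ^ m + 7"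
      using u(3) staircase_ge[OF m3 c(1), of "2 * i"] depth(1) by linarith
    then have "ln (ln (1 / u)) \<le> ln (B + 2 ^ m + 7)" using lll(1) by simp
    moreover have "0 < ln (ln (1 / u))" using lll(1) by (intro ln_gt_zero) auto
    ultimately have "ln (ln (ln (1 / u))) \<le> ln (ln (B + 2 ^ m + 7))" by simp
    then have "ln (ln (ln (1 / u))) \<le> 6 * real m" using depth(2) by linarith
    moreover have "0 < ln (ln (ln (1 / u)))" using lll(2) by linarith
    ultimately have "1 / (6 * real m) \<le> 1 / ln (ln (ln (1 / u)))"
      by (intro frac_le) simp_all
    then show ?thesis using osc u hump unfolding u_def by simp
  qed
qed

end

text \<open>A trial succeeds with probability at least \<open>1 / 4 ^ (10 * 8 ^ m)\<close>. The
  exponent allows for \<open>4 ^ (11 * 8 ^ m)\<close> trials, and a further factor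
  \<open>4 ^ (8 ^ m)\<close> covers the \<open>m\<close> levels that each one takes.\<close>

definition window_depth :: "nat \<Rightarrow> nat" where
  "window_depth m = 4 ^ (12 * 8 ^ m)"

lemma window_depth_ge: "2 ^ m + 7 \<le> window_depth m" "m \<le> window_depth m"
proof -
  have "2 ^ m * 8 \<le> (2::nat) ^ (m + 3)" by (simp add: power_add)
  also have "\<dots> \<le> 2 ^ (24 * 8 ^ m)"
  proof (intro power_increasing)
    have "m < 8 ^ m" by (rule less_exp[THEN less_le_trans]) (intro power_mono; simp)
    then show "m + 3 \<le> 24 * 8 ^ m" by linarith
  qed simp
  also have "\<dots> = window_depth m"
    unfolding window_depth_def by (simp add: power_mult flip: power_mult[of "2::nat" 2, simplified])
  finally have *: "2 ^ m * 8 \<le> window_depth m" .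
  moreover have "1 \<le> (2::nat) ^ m" by simp
  ultimately show "2 ^ m + 7 \<le> window_depth m" by linarith
  have "m < 2 ^ m" by (rule less_exp)
  with * show "m \<le> window_depth m" by linarith
qed

text \<open>Here the triple logarithm matches the doubly exponential depth: two further logarithms
  of the depth are linear in \<open>m\<close>, like the harmonic sum of a window. The square comes
  from at most \<open>window_depth m\<close> ratios, each at least
  \<open>exp (- window_depth m)\<close>.\<close>

lemma ln_ln_window_depth_le:
  assumes "3 \<le> m"
  shows "ln (ln ((real (window_depth m))\<^sup>2 + 2 ^ m + 7)) \<le> 6 * real m"
proof -
  define L where "L = real (window_depth m)"
  have "real (2 ^ m + 7) \<le> L" unfolding L_def by (simp only: of_nat_le_iff window_depth_ge)
  then have L: "2 ^ m + 7 \<le> L" by simp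
  moreover have "1 \<le> (2::real) ^ m" by simp
  ultimately have L2: "2 \<le> L" by linarith
  have "L\<^sup>2 + 2 ^ m + 7 \<le> L\<^sup>2 + L" using L by simp
  also have "\<dots> \<le> L\<^sup>2 + L\<^sup>2" using L2 by (simp add: power2_eq_square)
  also have "\<dots> \<le> L ^ 3"
    using mult_right_mono[OF L2, of "L\<^sup>2"] by (simp add: power2_eq_square power3_eq_cube mult.assoc)
  finally have "ln (L\<^sup>2 + 2 ^ m + 7) \<le> ln (L ^ 3)"
    using L2 by (subst ln_le_cancel_iff) (auto intro!: add_nonneg_pos)
  also have "\<dots> = 36 * 8 ^ m * ln 4"
    using L2 by (simp add: ln_realpow L_def window_depth_def)
  also have "\<dots> \<le> 36 * 8 ^ m * 3"
    using ln_le_minus_one[of "4::real"] by (intro mult_left_mono) auto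
  also have "\<dots> \<le> 8 ^ (m + 3)" by (simp add: power_add)
  finally have 1: "ln (L\<^sup>2 + 2 ^ m + 7) \<le> 8 ^ (m + 3)" .
  have "1 < L\<^sup>2 + 2 ^ m + 7" by (simp add: add_pos_pos power2_eq_square add_nonneg_pos)
  then have "0 < ln (L\<^sup>2 + 2 ^ m + 7)" by simp
  then have "ln (ln (L\<^sup>2 + 2 ^ m + 7)) \<le> ln (8 ^ (m + 3))" using 1 by simp
  also have "\<dots> = real (m + 3) * ln 8" by (simp add: ln_realpow)
  also have "\<dots> \<le> real (m + 3) * 3"
  proof (intro mult_left_mono)
    have "ln (8::real) = ln (2 ^ 3)" by simp
    also have "\<dots> = 3 * ln 2" by (simp add: ln_realpow del: power_numeral)
    also have "\<dots> \<le> 3" using ln_le_minus_one[of "2::real"] by simp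
    finally show "ln (8::real) \<le> 3" .
  qed simp
  finally show ?thesis using assms unfolding L_def by simp
qed

section \<open>The deterministic divergence theorem\<close>

context splitting_ratios
begin

text \<open>\<open>half\<close> and \<open>right\<close> handle the two ends of the circle and
  \<open>windows\<close> supplies the oscillation. The lower bounds on the ratios keep the left edge
  value from becoming so small that the amplitude drops below \<open>1 / (6 * m)\<close>.\<close>

theorem not_convergent_periodic_osc:
  assumes pos: "\<And>n. n \<ge> 1 \<Longrightarrow> 0 < x n 1"
    and half: "\<And>m. \<exists>n>m. x n 1 \<le> 1 / 2"
    and right: "\<exists>n\<ge>1. 1 / 2 \<le> x n (2 ^ n - 1)"
    and windows: "\<And>m0. \<exists>m\<ge>m0. \<exists>q. m \<le> q \<and> q \<le> window_depth m \<and> window_good m q x \<and>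
      (\<forall>n\<in>{1..q}. exp (- real (window_depth m)) \<le> x n 1)"
  shows "\<not> convergent (\<lambda>n. fourier_partial_sum n (periodic_osc \<circ> dyadic_extension x) 0)"
proof -
  obtain r where r: "r \<ge> 1" "1 / 2 \<le> x r (2 ^ r - 1)" using right by blast
  interpret bounded_at_circle "periodic_osc \<circ> dyadic_extension x" "1 - 1 / 2 ^ r"
    by (rule bounded_at_circle_comp[OF half r])
  have "\<forall>\<^sub>F q in sequentially. dyadic_val x q 1 < osc_end"
    using left_edge_tendsto_0[OF half] osc_end_bounds by (intro order_tendstoD)
  then obtain q0 where q0: "\<And>q. q \<ge> q0 \<Longrightarrow> dyadic_val x q 1 < osc_end"
    by (auto simp: eventually_sequentially)
  show ?thesis
  proof (rule not_convergent_fourier_partial_sum)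
    show "0 \<le> (periodic_osc \<circ> dyadic_extension x) t" for t by (simp add: periodic_osc_range)
    fix m0 :: nat
    obtain m q where m: "max (max m0 q0) 4 \<le> m" and q: "m \<le> q" "q \<le> window_depth m"
      and good: "window_good m q x" and low: "\<And>n. n \<in> {1..q} \<Longrightarrow> exp (- real (window_depth m)) \<le> x n 1"
      using windows by blast
    define L where "L = real (window_depth m)"
    have prod: "dyadic_val x q 1 = (\<Prod>n=1..q. x n 1)" by (rule dyadic_val_1)
    have z: "0 < dyadic_val x q 1" unfolding prod using pos by (intro prod_pos) auto
    have nz: "x n 1 \<noteq> 0" if "n \<in> {1..q}" for n using pos[of n] that by simp
    have "ln (dyadic_val x q 1) = (\<Sum>n=1..q. ln (x n 1))"
      unfolding prod by (intro ln_prod nz) auto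
    also have "\<dots> \<ge> (\<Sum>n=1..q. - L)"
      using low pos by (intro sum_mono) (auto simp: L_def ln_ge_iff)
    finally have "- ln (dyadic_val x q 1) \<le> real q * L" by simp
    also have "\<dots> \<le> L * L" using q by (intro mult_right_mono) (auto simp: L_def)
    finally have B: "- ln (dyadic_val x q 1) \<le> L\<^sup>2" by (simp add: power2_eq_square)
    note w = window[OF _ z q0 good B, folded L_def]
    show "\<exists>m q. m0 \<le> m \<and> m \<le> q \<and> (\<forall>i<2 ^ (m - 4). \<forall>t.
      (real i + 1 / 2 \<le> 2 ^ (q + m - 3) * t \<and> 2 ^ (q + m - 3) * t \<le> real i + 1
        \<longrightarrow> (periodic_osc \<circ> dyadic_extension x) t = 0) \<and>
      (real i + 1 / 8 \<le> 2 ^ (q + m - 3) * t \<and> 2 ^ (q + m - 3) * t \<le> real i + 3 / 8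
        \<longrightarrow> 1 / (6 * real m) \<le> (periodic_osc \<circ> dyadic_extension x) t))"
      using m q ln_ln_window_depth_le[of m] w unfolding L_def
      by (intro exI[of _ m] exI[of _ q]) auto
  qed
qed

end

section \<open>Random splitting ratios\<close>

locale uniform_splitting = prob_space M for M :: "'w measure" +
  fixes X :: "nat \<Rightarrow> nat \<Rightarrow> 'w \<Rightarrow> real"
  assumes indep: "indep_vars (\<lambda>_. borel) (\<lambda>(n, k). X n k) dyadic_index"
    and unif: "(n, k) \<in> dyadic_index \<Longrightarrow> distr M borel (X n k) = uniform_measure lborel {0..1}"
begin

abbreviation ratios :: "'w \<Rightarrow> nat \<Rightarrow> nat \<Rightarrow> real" where
  "ratios \<omega> \<equiv> \<lambda>n k. X n k \<omega>"

lemma ratio_measurable: "(n, k) \<in> dyadic_index \<Longrightarrow> X n k \<in> borel_measurable M"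
  using indep unfolding indep_vars_def by auto

lemma prob_ratio:
  assumes "(n, k) \<in> dyadic_index" "A \<in> sets borel"
  shows "prob (X n k -` A \<inter> space M) = measure lborel ({0..1} \<inter> A)"
proof -
  have "prob (X n k -` A \<inter> space M) = measure (distr M borel (X n k)) A"
    using assms by (simp add: measure_distr ratio_measurable)
  also have "\<dots> = measure (uniform_measure lborel {0..1}) A" by (simp add: unif assms)
  also have "\<dots> = measure lborel ({0..1} \<inter> A) / measure lborel {0..1::real}"
    using assms by (intro measure_uniform_measure) auto
  finally show ?thesis by simp
qed

lemma prob_ratio_inter:
  assumes J: "finite J" "J \<subseteq> dyadic_index" and A: "\<And>i. i \<in> J \<Longrightarrow> A i \<in> sets borel"
  shows "prob {\<omega> \<in> space M. \<forall>(n, k)\<in>J. X n k \<omega> \<in> A (n, k)} = (\<Prod>i\<in>J. measure lborel ({0..1} \<inter> A i))"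
proof (cases "J = {}")
  case True
  then show ?thesis by (simp add: prob_space)
next
  case False
  have "{\<omega> \<in> space M. \<forall>(n, k)\<in>J. X n k \<omega> \<in> A (n, k)} = (\<Inter>i\<in>J. (\<lambda>(n, k). X n k) i -` A i \<inter> space M)"
    using False by auto
  then have "prob {\<omega> \<in> space M. \<forall>(n, k)\<in>J. X n k \<omega> \<in> A (n, k)}
      = (\<Prod>i\<in>J. prob ((\<lambda>(n, k). X n k) i -` A i \<inter> space M))"
    using indep_varsD[OF indep False J(1,2), of A] A by simp
  also have "\<dots> = (\<Prod>i\<in>J. measure lborel ({0..1} \<inter> A i))"
    using J A by (intro prod.cong) (auto simp: prob_ratio)
  finally show ?thesis .
qed

text \<open>The sigma-algebra generated by the ratios with indices in \<open>K\<close>, through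
  their joint map into the product space.\<close>

definition info :: "(nat \<times> nat) set \<Rightarrow> 'w measure" where
  "info K = vimage_algebra (space M) (\<lambda>\<omega>. \<lambda>(n, k)\<in>K. X n k \<omega>) (PiM K (\<lambda>_. borel))"

lemma restrict_funcset: "(\<lambda>\<omega>. \<lambda>(n, k)\<in>K. X n k \<omega>) \<in> space M \<rightarrow> space (PiM K (\<lambda>_. borel))"
  by (auto simp: space_PiM)

lemma space_info [simp]: "space (info K) = space M"
  by (simp add: info_def)

lemma info_measurable:
  assumes "(n, k) \<in> K"
  shows "X n k \<in> borel_measurable (info K)"
proof -
  have "(\<lambda>\<omega>. (\<lambda>(n, k)\<in>K. X n k \<omega>) (n, k)) \<in> borel_measurable (info K)"
    unfolding info_def using assms
    by (intro measurable_compose[OF measurable_vimage_algebra1[OF restrict_funcset] measurable_component_singleton]) auto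
  then show ?thesis using assms by (simp add: restrict_def)
qed

lemma info_indep:
  assumes "K \<inter> K' = {}" "K \<subseteq> dyadic_index" "K' \<subseteq> dyadic_index"
    and "A \<in> sets (info K)" "B \<in> sets (info K')"
  shows "prob (A \<inter> B) = prob A * prob B"
proof -
  let ?r = "\<lambda>K \<omega>. restrict (\<lambda>i. (\<lambda>(n, k). X n k) i \<omega>) K"
  have r: "?r K = (\<lambda>\<omega>. \<lambda>(n, k)\<in>K. X n k \<omega>)" for K
    by (auto simp: fun_eq_iff restrict_def)
  obtain A' where A: "A' \<in> sets (PiM K (\<lambda>_. borel))" "A = ?r K -` A' \<inter> space M"
    using assms(4) unfolding info_def sets_vimage_algebra2[OF restrict_funcset] r by auto
  obtain B' where B: "B' \<in> sets (PiM K' (\<lambda>_. borel))" "B = ?r K' -` B' \<inter> space M"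
    using assms(5) unfolding info_def sets_vimage_algebra2[OF restrict_funcset] r by auto
  have "A \<inter> B = (\<lambda>\<omega>. (?r K \<omega>, ?r K' \<omega>)) -` (A' \<times> B') \<inter> space M"
    unfolding A B by auto
  then show ?thesis
    using indep_varD[OF indep_var_restrict[OF indep assms(1-3)] A(1) B(1)] A(2) B(2) by simp
qed

lemma info_events:
  assumes "K \<subseteq> dyadic_index" "A \<in> sets (info K)"
  shows "A \<in> events"
proof -
  have "(\<lambda>\<omega>. \<lambda>i\<in>K. (case i of (n, k) \<Rightarrow> X n k \<omega>)) \<in> measurable M (PiM K (\<lambda>_. borel))"
    using assms(1) by (intro measurable_restrict) (auto intro: ratio_measurable)
  then show ?thesis
    using assms(2) unfolding info_def sets_vimage_algebra2[OF restrict_funcset]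
    by (auto simp: measurable_sets)
qed

text \<open>One index per level is tested. Failure at \<open>r\<close> successive levels has
  probability \<open>(1 / 2) ^ r\<close> by independence, and permanent failure beyond
  \<open>m\<close> is contained in all these events.\<close>

lemma AE_infinitely_often:
  assumes idx: "\<And>n. n \<ge> 1 \<Longrightarrow> (n, k n) \<in> dyadic_index"
    and A: "A \<in> sets borel" "measure lborel ({0..1} \<inter> (- A)) = 1 / 2"
  shows "AE \<omega> in M. \<exists>n>m. X n (k n) \<omega> \<in> A"
proof -
  define N where "N = {\<omega> \<in> space M. \<forall>n>m. X n (k n) \<omega> \<notin> A}"
  define F where "F r = {\<omega> \<in> space M. \<forall>(n, j)\<in>(\<lambda>n. (n, k n)) ` {m<..m + r}. X n j \<omega> \<in> - A}" for r
  have J: "(\<lambda>n. (n, k n)) ` {m<..m + r} \<subseteq> dyadic_index" for r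
    using idx by auto
  have prob_F: "prob (F r) = (1 / 2) ^ r" for r
  proof -
    have "prob (F r) = (\<Prod>i\<in>(\<lambda>n. (n, k n)) ` {m<..m + r}. measure lborel ({0..1} \<inter> - A))"
      unfolding F_def using A by (intro prob_ratio_inter[where A = "\<lambda>_. - A"] J) auto
    then show ?thesis using A by (simp add: card_image inj_on_def)
  qed
  have F_events: "F r \<in> events" for r
  proof -
    have "{\<omega> \<in> space M. X n j \<omega> \<in> - A} \<in> events" if "(n, j) \<in> (\<lambda>n. (n, k n)) ` {m<..m + r}" for n j
      using A that J[of r] measurable_sets[OF ratio_measurable, of n j "- A"]
      by (auto simp: vimage_def Int_def conj_commute)
    then show ?thesis unfolding F_def by (intro sets.sets_Collect_finite_All) auto
  qed
  have "N = (\<Inter>r. F r)"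
    unfolding N_def F_def by (auto simp: image_iff) (metis greaterThanAtMost_iff le_add_diff_inverse less_imp_le order_refl)
  then have N: "N \<in> events" "N \<subseteq> F r" for r using F_events by auto
  have "prob N \<le> (1 / 2) ^ r" for r
    using finite_measure_mono[OF N(2) F_events] prob_F by simp
  moreover have "(\<lambda>r. (1 / 2 :: real) ^ r) \<longlonglongrightarrow> 0" by (intro LIMSEQ_power_zero) simp
  ultimately have "prob N \<le> 0" by (intro LIMSEQ_le_const) auto
  then have "prob N = 0" by (simp add: measure_le_0_iff)
  then have "AE \<omega> in M. \<omega> \<notin> N" using N(1) by (simp add: prob_eq_0)
  then show ?thesis
    by (rule AE_mp) (auto simp: N_def)
qed

end

section \<open>The probability of a good window\<close>

definition window_index :: "nat \<Rightarrow> (nat \<times> nat) set" where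
  "window_index m = {(s, j) \<in> dyadic_index. s \<le> m}"

lemma window_index_subset: "window_index m \<subseteq> {..m} \<times> {..<2 ^ m}"
proof -
  have "j < 2 ^ m" if "j < 2 ^ s" "s \<le> m" for s j :: nat
    using that(1) power_increasing[OF that(2), of "2::nat"] by linarith
  then show ?thesis by (auto simp: window_index_def dyadic_index_def)
qed

lemma finite_window_index: "finite (window_index m)"
  using window_index_subset by (rule finite_subset) auto

lemma card_window_index_le: "card (window_index m) \<le> 4 ^ m"
proof -
  have "card (window_index m) \<le> card ({..m} \<times> {..<2 ^ m :: nat})"
    using window_index_subset by (intro card_mono) auto
  also have "\<dots> = (m + 1) * 2 ^ m" by simp
  also have "\<dots> \<le> 2 ^ m * 2 ^ m" using less_exp[of m] by (intro mult_right_mono) (auto simp: Suc_le_eq)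
  also have "\<dots> = 4 ^ m" by (simp flip: power_mult_distrib)
  finally show ?thesis .
qed

text \<open>At worst \<open>r\<close> is an end of the unit interval and half of its neighbourhood
  is lost.\<close>

lemma measure_unit_inter_ge:
  fixes r \<eta> :: real
  assumes "0 \<le> r" "r \<le> 1" "0 \<le> \<eta>" "\<eta> \<le> 1 / 2"
  shows "\<eta> \<le> measure lborel ({0..1} \<inter> {r - \<eta>..r + \<eta>})"
proof -
  have "{0..1} \<inter> {r - \<eta>..r + \<eta>} = {max 0 (r - \<eta>)..min 1 (r + \<eta>)}" by auto
  then show ?thesis using assms by (auto simp: measure_def emeasure_lborel_Icc_eq max_def min_def)
qed

lemma tolerance_bounds: "0 < tolerance m" "tolerance m \<le> 1 / 2"
proof -
  show "0 < tolerance m" by (simp add: tolerance_def)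
  have "tolerance m \<le> (1 / 4) ^ 1"
    unfolding tolerance_def by (intro power_decreasing) auto
  then show "tolerance m \<le> 1 / 2" by simp
qed

definition window_close :: "nat \<Rightarrow> nat \<Rightarrow> nat \<Rightarrow> (nat \<Rightarrow> nat \<Rightarrow> real) \<Rightarrow> bool" where
  "window_close m q c x \<longleftrightarrow> (\<forall>(s, j)\<in>window_index m.
    \<bar>x (q + s) j - target_ratio (staircase c m) m s j\<bar> \<le> tolerance m)"

text \<open>The product is \<open>dyadic_val x q 1\<close>, by \<open>dyadic_val_1\<close>; written
  this way it is plainly measurable with respect to the past.\<close>

definition window_phase :: "nat \<Rightarrow> nat \<Rightarrow> (nat \<Rightarrow> nat \<Rightarrow> real) \<Rightarrow> bool" where
  "window_phase q c x \<longleftrightarrow> 7 / 10 \<le> cos (ln (\<Prod>n=1..q. x n 1) - phase c)"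

lemma window_good_iff: "window_good m q x \<longleftrightarrow> (\<exists>c\<in>{..<4}. window_phase q c x \<and> window_close m q c x)"
  unfolding window_good_def window_close_def window_phase_def window_index_def dyadic_val_1 by auto

definition past :: "nat \<Rightarrow> (nat \<times> nat) set" where
  "past q = {(n, k) \<in> dyadic_index. n \<le> q}"

definition future :: "nat \<Rightarrow> (nat \<times> nat) set" where
  "future q = {(n, k) \<in> dyadic_index. q < n}"

context uniform_splitting
begin

lemma window_close_sets:
  assumes "\<And>s j. (s, j) \<in> window_index m \<Longrightarrow> (q + s, j) \<in> K"
  shows "{\<omega> \<in> space M. window_close m q c (ratios \<omega>)} \<in> sets (info K)"
proof -
  have "{\<omega> \<in> space (info K). \<bar>X (q + s) j \<omega> - target_ratio (staircase c m) m s j\<bar> \<le> tolerance m} \<in> sets (info K)"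
    if "(s, j) \<in> window_index m" for s j
  proof -
    have [measurable]: "X (q + s) j \<in> borel_measurable (info K)"
      using assms[OF that] by (rule info_measurable)
    show ?thesis by measurable
  qed
  then show ?thesis unfolding window_close_def
    using finite_window_index by (subst space_info[of K, symmetric], intro sets.sets_Collect_finite_All) auto
qed

lemma window_phase_sets:
  assumes "past q \<subseteq> K"
  shows "{\<omega> \<in> space M. window_phase q c (ratios \<omega>)} \<in> sets (info K)"
proof -
  have "X n 1 \<in> borel_measurable (info K)" if "n \<in> {1..q}" for n
  proof (rule info_measurable)
    have "(1::nat) < 2 ^ n" using that by (intro one_less_power) auto
    then show "(n, 1) \<in> K" using assms that by (auto simp: past_def dyadic_index_def)
  qed
  then have [measurable]: "(\<lambda>\<omega>. \<Prod>n=1..q. X n 1 \<omega>) \<in> borel_measurable (info K)"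
    by (rule borel_measurable_prod)
  have "{\<omega> \<in> space (info K). 7 / 10 \<le> cos (ln (\<Prod>n=1..q. X n 1 \<omega>) - phase c)} \<in> sets (info K)"
    by measurable
  then show ?thesis by (simp add: window_phase_def)
qed

lemma window_good_sets:
  assumes "past (q + m) \<subseteq> K"
  shows "{\<omega> \<in> space M. window_good m q (ratios \<omega>)} \<in> sets (info K)"
proof -
  have "past q \<subseteq> K" using assms by (auto simp: past_def)
  moreover have "(q + s, j) \<in> K" if "(s, j) \<in> window_index m" for s j
    using assms that shift_index[of s j q] by (auto simp: past_def window_index_def)
  ultimately show ?thesis
    using window_close_sets[of m q K] window_phase_sets[of q K] unfolding window_good_iff
    by (subst space_info[of K, symmetric], intro sets.sets_Collect_finite_Ex sets.sets_Collect_conj) auto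
qed

text \<open>At most \<open>4 ^ m\<close> independent ratios have to hit their targets, each with
  probability at least \<open>tolerance m\<close>.\<close>

lemma prob_window_close_ge:
  assumes "3 \<le> m"
  shows "tolerance m ^ 4 ^ m \<le> prob {\<omega> \<in> space M. window_close m q c (ratios \<omega>)}"
proof -
  define J where "J = (\<lambda>(s, j). (q + s, j)) ` window_index m"
  define A where "A i = (case i of (n, j) \<Rightarrow> {target_ratio (staircase c m) m (n - q) j - tolerance m ..
    target_ratio (staircase c m) m (n - q) j + tolerance m})" for i
  have J: "finite J" "J \<subseteq> dyadic_index" "card J \<le> 4 ^ m"
    unfolding J_def using finite_window_index card_image_le[OF finite_window_index, of "\<lambda>(s, j). (q + s, j)" m]
      card_window_index_le[of m] by (auto simp: window_index_def intro: shift_index)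
  have "tolerance m ^ 4 ^ m \<le> tolerance m ^ card J"
    using tolerance_bounds[of m] J(3) by (intro power_decreasing) auto
  also have "\<dots> = (\<Prod>i\<in>J. tolerance m)" by simp
  also have "\<dots> \<le> (\<Prod>i\<in>J. measure lborel ({0..1} \<inter> A i))"
    using target_ratio_range[OF staircase_mono[OF assms], of c] tolerance_bounds[of m]
    by (intro prod_mono) (auto simp: A_def intro!: measure_unit_inter_ge)
  also have "\<dots> = prob {\<omega> \<in> space M. \<forall>(n, k)\<in>J. X n k \<omega> \<in> A (n, k)}"
    using J by (intro prob_ratio_inter[symmetric]) (auto simp: A_def)
  also have "{\<omega> \<in> space M. \<forall>(n, k)\<in>J. X n k \<omega> \<in> A (n, k)} = {\<omega> \<in> space M. window_close m q c (ratios \<omega>)}"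
    by (auto simp: J_def A_def window_close_def abs_le_iff)
  finally show ?thesis .
qed

text \<open>The phase that the next window has to match depends on the past, so the past is split
  according to the first matching phase; for each fixed phase the window is independent of the past.\<close>

lemma prob_no_good_window_le:
  assumes "3 \<le> m"
  shows "prob {\<omega> \<in> space M. \<forall>t\<in>{1..T}. \<not> window_good m (t * m) (ratios \<omega>)} \<le> (1 - tolerance m ^ 4 ^ m) ^ T"
proof (induction T)
  case 0
  then show ?case by (simp add: prob_space)
next
  case (Suc T)
  define p where "p = tolerance m ^ 4 ^ m"
  \<comment> \<open>Window \<open>t\<close> involves, beyond its own past, the levels
    \<open>t * m + 1\<close> to \<open>(t + 1) * m\<close>; hence the first \<open>T\<close> windows
    are determined by the past of this \<open>q\<close>.\<close>
  define q where "q = Suc T * m"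
  define Bad where "Bad = {\<omega> \<in> space M. \<forall>t\<in>{1..T}. \<not> window_good m (t * m) (ratios \<omega>)}"
  define C where "C c = {\<omega> \<in> space M. window_phase q c (ratios \<omega>) \<and> (\<forall>c'\<in>{..<c}. \<not> window_phase q c' (ratios \<omega>))}" for c
  define W where "W c = {\<omega> \<in> space M. \<not> window_close m q c (ratios \<omega>)}" for c
  have sub: "past q \<subseteq> dyadic_index" "future q \<subseteq> dyadic_index" "past q \<inter> future q = {}"
    by (auto simp: past_def future_def)
  have "past (t * m + m) \<subseteq> past q" if "t \<in> {1..T}" for t
  proof -
    have "Suc t * m \<le> q" unfolding q_def using that by (intro mult_right_mono) auto
    then show ?thesis by (auto simp: past_def)
  qed
  then have Bad: "Bad \<in> sets (info (past q))"
    unfolding Bad_def using window_good_sets[of _ m "past q"]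
    by (subst space_info[of "past q", symmetric], intro sets.sets_Collect_finite_All sets.sets_Collect_neg) auto
  have C: "C c \<in> sets (info (past q))" for c
    unfolding C_def using window_phase_sets[of q "past q"]
    by (subst space_info[of "past q", symmetric],
        intro sets.sets_Collect_conj sets.sets_Collect_finite_All sets.sets_Collect_neg) auto
  have idx: "(q + s, j) \<in> future q" if "(s, j) \<in> window_index m" for s j
    using that shift_index[of s j q] by (auto simp: window_index_def future_def dyadic_index_def)
  have close: "{\<omega> \<in> space M. window_close m q c (ratios \<omega>)} \<in> sets (info (future q))" for c
    using idx by (rule window_close_sets)
  then have W: "W c \<in> sets (info (future q))" for c
    unfolding W_def by (subst space_info[of "future q", symmetric], intro sets.sets_Collect_neg) auto
  have "W c = space M - {\<omega> \<in> space M. window_close m q c (ratios \<omega>)}" for c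
    by (auto simp: W_def)
  then have prob_W: "prob (W c) \<le> 1 - p" for c
    using prob_window_close_ge[OF assms, of q c] prob_compl[OF info_events[OF sub(2) close[of c]]]
    by (simp add: p_def)
  have "{\<omega> \<in> space M. \<forall>t\<in>{1..Suc T}. \<not> window_good m (t * m) (ratios \<omega>)} \<subseteq> (\<Union>c\<in>{..<4}. Bad \<inter> C c \<inter> W c)"
  proof
    fix \<omega> assume \<omega>: "\<omega> \<in> {\<omega> \<in> space M. \<forall>t\<in>{1..Suc T}. \<not> window_good m (t * m) (ratios \<omega>)}"
    have ex: "\<exists>c. c < 4 \<and> window_phase q c (ratios \<omega>)"
      unfolding window_phase_def using exists_phase by blast
    define c where "c = (LEAST c. c < 4 \<and> window_phase q c (ratios \<omega>))"
    have c: "c < 4" "window_phase q c (ratios \<omega>)"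
      using LeastI_ex[OF ex] by (auto simp: c_def)
    have "\<not> window_phase q c' (ratios \<omega>)" if "c' < c" for c'
      using not_less_Least[of c'] that c(1) unfolding c_def by fastforce
    moreover have "\<not> window_good m q (ratios \<omega>)"
      unfolding q_def using \<omega> by (auto dest!: bspec[of _ _ "Suc T"])
    then have "\<not> window_close m q c (ratios \<omega>)" using c by (auto simp: window_good_iff)
    ultimately show "\<omega> \<in> (\<Union>c\<in>{..<4}. Bad \<inter> C c \<inter> W c)"
      using c \<omega> by (auto simp: Bad_def C_def W_def)
  qed
  then have "prob {\<omega> \<in> space M. \<forall>t\<in>{1..Suc T}. \<not> window_good m (t * m) (ratios \<omega>)}
      \<le> prob (\<Union>c\<in>{..<4}. Bad \<inter> C c \<inter> W c)"
    using Bad C W sub by (intro finite_measure_mono sets.finite_UN sets.Int) (auto intro: info_events)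
  also have "\<dots> \<le> (\<Sum>c<4. prob (Bad \<inter> C c \<inter> W c))"
    using Bad C W sub by (intro finite_measure_subadditive_finite) (auto intro: info_events)
  also have "\<dots> = (\<Sum>c<4. prob (Bad \<inter> C c) * prob (W c))"
    using Bad C W sub by (intro sum.cong info_indep[of "past q" "future q"]) auto
  also have "\<dots> \<le> (\<Sum>c<4. prob (Bad \<inter> C c) * (1 - p))"
    by (intro sum_mono mult_left_mono prob_W) auto
  also have "\<dots> = (\<Sum>c<4. prob (Bad \<inter> C c)) * (1 - p)" by (rule sum_distrib_right[symmetric])
  \<comment> \<open>The events \<open>C c\<close> are disjoint, as \<open>c\<close> is the first
    matching phase, so summing over the phases costs no factor \<open>4\<close>.\<close>
  also have "(\<Sum>c<4. prob (Bad \<inter> C c)) = prob (\<Union>c\<in>{..<4}. Bad \<inter> C c)"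
  proof (rule finite_measure_finite_Union[symmetric])
    show "disjoint_family_on (\<lambda>c. Bad \<inter> C c) {..<4}"
      unfolding disjoint_family_on_def
    proof (intro ballI impI)
      fix c c' :: nat assume "c \<noteq> c'"
      then show "Bad \<inter> C c \<inter> (Bad \<inter> C c') = {}"
        by (cases c c' rule: linorder_cases) (auto simp: C_def)
    qed
  qed (use Bad C sub in \<open>auto intro: info_events\<close>)
  also have "\<dots> * (1 - p) \<le> prob Bad * (1 - p)"
  proof (intro mult_right_mono finite_measure_mono)
    show "Bad \<in> events" using Bad sub by (auto intro: info_events)
    show "0 \<le> 1 - p"
      using tolerance_bounds[of m] by (simp add: p_def power_le_one)
  qed auto
  also have "\<dots> \<le> (1 - p) ^ T * (1 - p)"
    using Suc.IH tolerance_bounds[of m] by (intro mult_right_mono) (auto simp: p_def Bad_def power_le_one)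
  finally show ?case by (simp add: p_def mult.commute)
qed

end

section \<open>Almost sure occurrence of good windows\<close>

context uniform_splitting
begin

text \<open>Success probability times number of trials is \<open>4 ^ (8 ^ m)\<close>, and
  \<open>(1 - p) ^ T \<le> exp (- (p * T))\<close> is then far below \<open>1 / m\<close>.\<close>

lemma prob_no_good_window_le_inverse:
  assumes "3 \<le> m"
  shows "prob {\<omega> \<in> space M. \<forall>t\<in>{1..4 ^ (11 * 8 ^ m)}. \<not> window_good m (t * m) (ratios \<omega>)} \<le> 1 / real m"
proof -
  define p where "p = tolerance m ^ 4 ^ m"
  have p: "0 \<le> p" "p \<le> 1" using tolerance_bounds[of m] by (auto simp: p_def power_le_one)
  have "p = (1 / 4) ^ (10 * (2 ^ m * 4 ^ m))"
    by (simp add: p_def tolerance_def power_mult mult.assoc)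
  also have "(2::nat) ^ m * 4 ^ m = 8 ^ m" by (simp flip: power_mult_distrib)
  finally have "p * 4 ^ (11 * 8 ^ m) = 4 ^ (11 * 8 ^ m) / 4 ^ (10 * 8 ^ m)"
    by (simp add: power_one_over)
  also have "\<dots> = 4 ^ (11 * 8 ^ m - 10 * 8 ^ m)" by (subst power_diff) auto
  also have "11 * 8 ^ m - 10 * 8 ^ m = (8::nat) ^ m" by simp
  finally have pR: "p * 4 ^ (11 * 8 ^ m) = 4 ^ (8 ^ m)" .
  have "m < 8 ^ m" by (rule less_exp[THEN less_le_trans]) (intro power_mono; simp)
  also have "8 ^ m < (4::nat) ^ (8 ^ m)" by (rule less_exp[THEN less_le_trans]) (intro power_mono; simp)
  finally have "real m \<le> real (4 ^ (8 ^ m))" by (simp only: of_nat_le_iff less_imp_le)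
  then have m: "real m \<le> 4 ^ (8 ^ m)" by simp
  have "prob {\<omega> \<in> space M. \<forall>t\<in>{1..4 ^ (11 * 8 ^ m)}. \<not> window_good m (t * m) (ratios \<omega>)}
      \<le> (1 - p) ^ 4 ^ (11 * 8 ^ m)"
    unfolding p_def using assms by (rule prob_no_good_window_le)
  also have "\<dots> \<le> exp (- p) ^ 4 ^ (11 * 8 ^ m)"
    using p exp_ge_add_one_self[of "- p"] by (intro power_mono) auto
  also have "\<dots> = exp (- (p * 4 ^ (11 * 8 ^ m)))"
    by (simp add: exp_of_nat_mult[symmetric] mult.commute)
  also have "\<dots> = 1 / exp (4 ^ (8 ^ m))" unfolding pR by (simp add: exp_minus inverse_eq_divide)
  also have "\<dots> \<le> 1 / real m"
  proof (rule frac_le)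
    show "real m \<le> exp (4 ^ (8 ^ m))"
      using m exp_ge_add_one_self[of "4 ^ (8 ^ m) :: real"] by linarith
  qed (use assms in auto)
  finally show ?thesis .
qed

text \<open>The union bound gives \<open>L * exp (- L)\<close>, and
  \<open>exp L \<ge> L\<^sup>2 / 2\<close>.\<close>

lemma prob_low_ratio_le:
  assumes "1 \<le> L"
  shows "prob {\<omega> \<in> space M. \<exists>n\<in>{1..L}. X n 1 \<omega> < exp (- real L)} \<le> 2 / real L"
proof -
  have idx: "(n, 1) \<in> dyadic_index" if "n \<in> {1..L}" for n
    using that one_less_power[of "2::nat" n] by (simp add: dyadic_index_def)
  have meas: "{\<omega> \<in> space M. X n 1 \<omega> < exp (- real L)} \<in> events" if "n \<in> {1..L}" for n
  proof -
    have [measurable]: "X n 1 \<in> borel_measurable M" using idx[OF that] by (rule ratio_measurable)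
    show ?thesis by measurable
  qed
  have "{\<omega> \<in> space M. \<exists>n\<in>{1..L}. X n 1 \<omega> < exp (- real L)}
      = (\<Union>n\<in>{1..L}. {\<omega> \<in> space M. X n 1 \<omega> < exp (- real L)})" by auto
  also have "prob \<dots> \<le> (\<Sum>n\<in>{1..L}. prob {\<omega> \<in> space M. X n 1 \<omega> < exp (- real L)})"
    using meas by (intro finite_measure_subadditive_finite) auto
  also have "\<dots> = (\<Sum>n\<in>{1..L}. exp (- real L))"
  proof (rule sum.cong[OF refl])
    fix n assume "n \<in> {1..L}"
    then have "prob (X n 1 -` {..<exp (- real L)} \<inter> space M) = measure lborel ({0..1} \<inter> {..<exp (- real L)})"
      by (intro prob_ratio idx) auto
    also have "X n 1 -` {..<exp (- real L)} \<inter> space M = {\<omega> \<in> space M. X n 1 \<omega> < exp (- real L)}" by auto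
    also have "exp (- real L) \<le> 1" by simp
    then have "{0..1} \<inter> {..<exp (- real L)} = {0..<exp (- real L)}"
      unfolding set_eq_iff Int_iff atLeastAtMost_iff lessThan_iff atLeastLessThan_iff by linarith
    finally show "prob {\<omega> \<in> space M. X n 1 \<omega> < exp (- real L)} = exp (- real L)" by simp
  qed
  also have "\<dots> = real L / exp (real L)" by (simp add: exp_minus field_simps)
  also have "\<dots> \<le> 2 / real L"
  proof -
    have "1 + real L + (real L)\<^sup>2 / 2 \<le> exp (real L)" by (rule exp_lower_Taylor_quadratic) simp
    then have "real L * real L \<le> 2 * exp (real L)" by (simp add: power2_eq_square)
    then show ?thesis using assms by (simp add: field_simps)
  qed
  finally show ?thesis .
qed

text \<open>Failure at every \<open>m \<ge> m0\<close> is contained in the failure at each single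
  large \<open>m\<close>, which has probability at most \<open>1 / m + 2 / m\<close>; let
  \<open>m\<close> grow.\<close>

lemma AE_windows:
  "AE \<omega> in M. \<exists>m\<ge>m0. \<exists>q. m \<le> q \<and> q \<le> window_depth m \<and> window_good m q (ratios \<omega>) \<and>
    (\<forall>n\<in>{1..q}. exp (- real (window_depth m)) \<le> X n 1 \<omega>)"
proof -
  define Bad where "Bad m = {\<omega> \<in> space M. \<forall>t\<in>{1..4 ^ (11 * 8 ^ m)}. \<not> window_good m (t * m) (ratios \<omega>)}" for m
  define Low where "Low m = {\<omega> \<in> space M. \<exists>n\<in>{1..window_depth m}. X n 1 \<omega> < exp (- real (window_depth m))}" for m
  have "{\<omega> \<in> space M. window_good m q (ratios \<omega>)} \<in> events" for m q
    by (rule info_events[OF subset_refl]) (rule window_good_sets, auto simp: past_def)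
  then have Bad: "Bad m \<in> events" for m
    unfolding Bad_def by (intro sets.sets_Collect_finite_All sets.sets_Collect_neg) auto
  have "{\<omega> \<in> space M. X n 1 \<omega> < r} \<in> events" if "n \<ge> 1" for n r
  proof -
    have [measurable]: "X n 1 \<in> borel_measurable M"
      using that one_less_power[of "2::nat" n] by (intro ratio_measurable) (simp add: dyadic_index_def)
    show ?thesis by measurable
  qed
  then have Low: "Low m \<in> events" for m
    unfolding Low_def by (intro sets.sets_Collect_finite_Ex) auto
  define N where "N = (\<Inter>m\<in>{m0..}. Bad m \<union> Low m)"
  have N: "N \<in> events" unfolding N_def using Bad Low by (intro sets.countable_INT') auto
  have le: "prob N \<le> 3 / real m" if "max m0 3 \<le> m" for m
  proof -
    have "1 \<le> window_depth m" using window_depth_ge(2)[of m] that by linarith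
    then have "prob (Low m) \<le> 2 / real (window_depth m)" unfolding Low_def by (rule prob_low_ratio_le)
    also have "\<dots> \<le> 2 / real m" using that window_depth_ge(2)[of m] by (intro divide_left_mono) auto
    finally have "prob (Low m) \<le> 2 / real m" .
    moreover have "prob (Bad m) \<le> 1 / real m"
      unfolding Bad_def using that by (intro prob_no_good_window_le_inverse) auto
    moreover have "prob N \<le> prob (Bad m \<union> Low m)"
      using that Bad Low unfolding N_def by (intro finite_measure_mono) auto
    moreover have "prob (Bad m \<union> Low m) \<le> prob (Bad m) + prob (Low m)"
      using Bad Low by (intro measure_Un_le) auto
    ultimately have "prob N \<le> 1 / real m + 2 / real m" by linarith
    then show ?thesis by (simp flip: add_divide_distrib)
  qed
  have "(\<lambda>m. 3 / real m) \<longlonglongrightarrow> 0" by (rule lim_const_over_n)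
  then have "prob N \<le> 0" using le by (intro LIMSEQ_le_const[of _ 0 "prob N"]) blast+
  then have "AE \<omega> in M. \<omega> \<notin> N" using N by (simp add: prob_eq_0 measure_le_0_iff)
  then show ?thesis
  proof (rule AE_mp[OF _ AE_I2], intro impI)
    fix \<omega> assume "\<omega> \<in> space M" "\<omega> \<notin> N"
    then obtain m where m: "m0 \<le> m" "\<omega> \<notin> Bad m" "\<omega> \<notin> Low m" unfolding N_def by auto
    then obtain t where t: "t \<in> {1..4 ^ (11 * 8 ^ m)}" "window_good m (t * m) (ratios \<omega>)"
      using \<open>\<omega> \<in> space M\<close> by (auto simp: Bad_def)
    have "m < 8 ^ m" by (rule less_exp[THEN less_le_trans]) (intro power_mono; simp)
    also have "8 ^ m < (4::nat) ^ (8 ^ m)" by (rule less_exp[THEN less_le_trans]) (intro power_mono; simp)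
    finally have "t * m \<le> 4 ^ (11 * 8 ^ m) * 4 ^ (8 ^ m)" using t(1) by (intro mult_mono) auto
    also have "\<dots> = window_depth m" by (simp add: window_depth_def flip: power_add)
    finally have depth: "t * m \<le> window_depth m" .
    then have "\<forall>n\<in>{1..t * m}. exp (- real (window_depth m)) \<le> X n 1 \<omega>"
      using m(3) \<open>\<omega> \<in> space M\<close> by (auto simp: Low_def not_less)
    then show "\<exists>m\<ge>m0. \<exists>q. m \<le> q \<and> q \<le> window_depth m \<and> window_good m q (ratios \<omega>) \<and>
        (\<forall>n\<in>{1..q}. exp (- real (window_depth m)) \<le> X n 1 \<omega>)"
      using m(1) t depth by (intro exI[of _ m] conjI exI[of _ "t * m"]) auto
  qed
qed

lemma AE_ratio_range: "AE \<omega> in M. \<forall>n k. (n, k) \<in> dyadic_index \<longrightarrow> 0 < X n k \<omega> \<and> X n k \<omega> \<le> 1"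
proof -
  have "AE \<omega> in M. 0 < X n k \<omega> \<and> X n k \<omega> \<le> 1" if "(n, k) \<in> dyadic_index" for n k
  proof -
    have "{0..1} \<inter> {0<..1} = {0<..1::real}" by auto
    then have "prob (X n k -` {0<..1} \<inter> space M) = 1" using prob_ratio[OF that, of "{0<..1}"] by simp
    then have "AE \<omega> in M. \<omega> \<in> X n k -` {0<..1} \<inter> space M" by (rule AE_prob_1)
    then show ?thesis by eventually_elim auto
  qed
  then show ?thesis by (simp add: AE_all_countable)
qed

lemma AE_not_convergent:
  "AE \<omega> in M. \<not> convergent (\<lambda>n. fourier_partial_sum n (periodic_osc \<circ> random_homeo X \<omega>) 0)"
proof -
  have half: "{0..1} \<inter> - {..1 / 2} = {1 / 2<..1::real}" "{0..1} \<inter> - {1 / 2..} = {0..<1 / 2::real}"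
    by auto
  have idx: "(n, 1) \<in> dyadic_index" "(n, 2 ^ n - 1) \<in> dyadic_index" if "n \<ge> 1" for n
    using that one_less_power[of "2::nat" n] by (auto simp: dyadic_index_def)
  have "AE \<omega> in M. \<forall>m. \<exists>n>m. X n 1 \<omega> \<in> {..1 / 2}"
    unfolding AE_all_countable using idx half by (intro allI AE_infinitely_often) auto
  moreover have "AE \<omega> in M. \<exists>n>0. X n (2 ^ n - 1) \<omega> \<in> {1 / 2..}"
    using idx half by (intro AE_infinitely_often) auto
  moreover have "AE \<omega> in M. \<forall>m0. \<exists>m\<ge>m0. \<exists>q. m \<le> q \<and> q \<le> window_depth m \<and> window_good m q (ratios \<omega>) \<and>
    (\<forall>n\<in>{1..q}. exp (- real (window_depth m)) \<le> X n 1 \<omega>)"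
    unfolding AE_all_countable using AE_windows by blast
  ultimately show ?thesis
    using AE_ratio_range
  proof eventually_elim
    case (elim \<omega>)
    interpret splitting_ratios "ratios \<omega>"
      using elim(4) by unfold_locales fastforce
    show ?case
      unfolding random_homeo_def
    proof (rule not_convergent_periodic_osc)
      show "0 < X n 1 \<omega>" if "n \<ge> 1" for n using elim(4) idx(1)[OF that] by blast
      show "\<exists>n>m. X n 1 \<omega> \<le> 1 / 2" for m using elim(1) by auto
      show "\<exists>n\<ge>1. 1 / 2 \<le> X n (2 ^ n - 1) \<omega>" using elim(2) by (auto simp: Suc_le_eq)
    qed (use elim(3) in blast)
  qed
qed

end

theorem theorem2:
  fixes M :: "'w measure" and X :: "nat \<Rightarrow> nat \<Rightarrow> 'w \<Rightarrow> real"
  assumes "prob_space M"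
    and "prob_space.indep_vars M (\<lambda>_. borel) (\<lambda>(n, k). X n k) dyadic_index"
    and "\<And>n k. (n, k) \<in> dyadic_index \<Longrightarrow>
           distr M borel (X n k) = uniform_measure lborel {0..1}"
  shows "\<exists>f :: real \<Rightarrow> real.
           continuous_on UNIV f \<and> (\<forall>x. f (x + 1) = f x) \<and>
           (\<lambda>\<delta>. f \<delta> - f 0) \<in> O[at 0](\<lambda>\<delta>. 1 / ln (ln (ln (1 / \<bar>\<delta>\<bar>)))) \<and>
           (AE \<omega> in M. \<not> convergent (\<lambda>n. fourier_partial_sum n (f \<circ> random_homeo X \<omega>) 0))"
proof -
  interpret prob_space M by (rule assms(1))
  interpret uniform_splitting M X using assms(2,3) by unfold_locales
  show ?thesis
    using continuous_periodic_osc periodic_osc_periodic periodic_osc_bigo AE_not_convergent by blast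
qed

end
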